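(* In the setting of the context, the Hilbert space $\mathcal H'=\{U'_x:x\in H\}$ constructed for the Cauchy dual operator $T'$ coincides with the Cauchy dual space $\mathcal B'$ of $(\mathcal H,\Psi,\mathcal L,M_z)$, i.e. the image of $\mathcal H^*$ under $\mathcal U$ with the norm induced from $\mathcal H^*$. Moreover, if $\varphi\in\mathcal H^*$ is represented by $g\in\mathcal H$, that is, $\varphi(f)=\langle f,g\rangle$ for all $f\in\mathcal H$, then $\mathcal U\varphi=U'U^*g$.
   Context: Notation: $\mathbb A(a,b)=\{z\in\mathbb C: a<|z|<b\}$; inner products are linear in the first variable; $\mathbf B(H)$ and $\mathbf B(E,\mathcal H)$ denote bounded linear operators; $\mathcal N(\cdot)$ is the kernel; $P_M$ is the orthogonal projection onto $M$; $\mathcal H^*$ is the space of bounded linear functionals on $\mathcal H$; $\mathrm{Hol}(A,E)$ is the space of $E$-valued holomorphic functions on $A$. Setting. $H$ is a complex Hilbert space, $T\in\mathbf B(H)$ is left-invertible, $T'=T(T^*T)^{-1}$ is its Cauchy dual, and $T'^*=(T')^*$. $E$ is a closed subspace of $H$ such that the closed linear span of $\{T^{*n}x: x\in E,n\ge0\}\cup\{T'^{n}x: x\in E,n\ge 0\}$ is $H$, and the closed linear span of $\{T'^{*n}x: x\in E,n\ge0\}\cup\{T^{n}x: x\in E,n\ge 0\}$ is $H$. For every $x\in H$ the series $$U_x(z)=\sum_{n=1}^\infty (P_ET^nx)\frac1{z^n}+\sum_{n=0}^\infty(P_ET'^{*n}x)z^n,\qquad U'_x(z)=\sum_{n=1}^\infty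 (P_ET'^nx)\frac1{z^n}+\sum_{n=0}^\infty(P_ET^{*n}x)z^n$$ are convergent in $E$ on the annuli $\Omega=\mathbb A(r^-,r^+)$ and $\Omega'=\mathbb A(r'^-,r'^+)$ respectively, where $0\le r^-<r^+$ and $0\le r'^-<r'^+$. Model spaces. $\mathcal H=\{U_x:x\in H\}$ and $\mathcal H'=\{U'_x:x\in H\}$. The maps $U:H\to\mathcal H$, $Ux=U_x$, and $U':H\to\mathcal H'$, $U'x=U'_x$, are injective, and $\mathcal H,\mathcal H'$ are given the norms induced from $H$, so that $U,U'$ are unitary. $M_z:\mathcal H\to\mathcal H$ is multiplication by $z$ (one has $M_z=UTU^*$), and $\mathcal L:\mathcal H\to\mathcal H$ is its left inverse $$(\mathcal Lf)(z)=\frac{f(z)-(P_{\mathcal N(M_z^* )}f)(z)}{z}$$ (one has $\mathcal L=UT'^*U^*$). Identifying $e\in E$ with $Ue\in\mathcal H$, define $\Psi:(\Omega')^*\to\mathbf B(E,\mathcal H)$, where $(\Omega')^*=\{\bar z:z\in\Omega'\}$, by $$\Psi(\lambda)e=\sum_{n=1}^\infty\frac1{\lambda^n}\mathcal L^nUe+\sum_{n=0}^\infty\lambda^nM_z^nUe .$$ Cauchy dual space of $(\mathcal H,\Psi,\mathcal L,M_z)$. $\mathcal U:\mathcal H^*\to\mathrm{Hol}(\Omega',E)$ is the (injective, conjugate-linear) map determined by $$\varphi(\Psi(\bar\lambda)e)=\langle e,(\mathcal U\varphi)(\lambda)\rangle,\qquad e\in E,\ \lambda\in\Omega',\ \varphi\in\mathcal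 H^*,$$ and $\mathcal B'$ is the image of $\mathcal U$ with the norm induced from $\mathcal H^*$, so that $\mathcal U:\mathcal H^*\to\mathcal B'$ is a surjective isometry. *)

theory Defs
  imports "HOL-Analysis.Analysis" "HOL-Library.Function_Algebras"
begin

section \<open>Complex Hilbert spaces\<close>

class scaleC =
  fixes scaleC :: "complex \<Rightarrow> 'a \<Rightarrow> 'a" (infixr \<open>*\<^sub>C\<close> 75)

class complex_vector = scaleC + ab_group_add +
  assumes scaleC_add_right: "a *\<^sub>C (x + y) = a *\<^sub>C x + a *\<^sub>C y"
    and scaleC_add_left: "(a + b) *\<^sub>C x = a *\<^sub>C x + b *\<^sub>C x"
    and scaleC_scaleC: "a *\<^sub>C b *\<^sub>C x = (a * b) *\<^sub>C x"
    and scaleC_one: "1 *\<^sub>C x = x"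

global_interpretation complex_vector: vector_space "scaleC :: complex \<Rightarrow> 'a \<Rightarrow> 'a :: complex_vector"
  defines csubspace_raw_def: csubspace = complex_vector.subspace
    and cspan_raw_def: cspan = complex_vector.span
  by unfold_locales (rule scaleC_add_right scaleC_add_left scaleC_scaleC scaleC_one)+

text \<open>The inner product is linear in the first variable. The metric and the topology are those
  of the underlying real normed space.\<close>

class complex_inner = complex_vector + real_normed_vector +
  fixes cinner :: "'a \<Rightarrow> 'a \<Rightarrow> complex"
  assumes scaleR_scaleC: "r *\<^sub>R x = complex_of_real r *\<^sub>C x"
    and cinner_commute: "cinner x y = cnj (cinner y x)"
    and cinner_add_left: "cinner (x + y) z = cinner x z + cinner y z"
    and cinner_scaleC_left: "cinner (c *\<^sub>C x) y = c * cinner x y"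
    and cinner_self: "cinner x x = complex_of_real ((norm x)\<^sup>2)"

class chilbert_space = complex_inner + complete_space

instantiation "fun" :: (type, complex_vector) complex_vector
begin

definition scaleC_fun :: "complex \<Rightarrow> ('a \<Rightarrow> 'b) \<Rightarrow> 'a \<Rightarrow> 'b"
  where "scaleC_fun c f = (\<lambda>x. c *\<^sub>C f x)"

instance
  by standard
    (simp_all add: scaleC_fun_def fun_eq_iff scaleC_add_right scaleC_add_left scaleC_scaleC scaleC_one)

end

definition bounded_clinear :: "('a::complex_inner \<Rightarrow> 'b::complex_inner) \<Rightarrow> bool"
  where "bounded_clinear f \<longleftrightarrow> bounded_linear f \<and> (\<forall>c x. f (c *\<^sub>C x) = c *\<^sub>C f x)"

text \<open>The next definitions take an inner product and a carrier as arguments, so that they apply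
  both to a whole type of class \<^class>\<open>chilbert_space\<close> and to a Hilbert space of functions, which
  is a proper subset of its type with an inner product of its own.

  \<open>adjoint_on V ipV ipW A\<close> is the adjoint of an operator \<open>A\<close> from the Hilbert space \<open>V\<close> with inner
  product \<open>ipV\<close> to a Hilbert space with inner product \<open>ipW\<close>.\<close>

definition adjoint_on ::
    "'a set \<Rightarrow> ('a \<Rightarrow> 'a \<Rightarrow> complex) \<Rightarrow> ('b \<Rightarrow> 'b \<Rightarrow> complex) \<Rightarrow> ('a \<Rightarrow> 'b) \<Rightarrow> 'b \<Rightarrow> 'a"
  where "adjoint_on V ipV ipW A w = (THE v. v \<in> V \<and> (\<forall>x\<in>V. ipW (A x) w = ipV x v))"

abbreviation cadjoint :: "('a::chilbert_space \<Rightarrow> 'b::chilbert_space) \<Rightarrow> 'b \<Rightarrow> 'a"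
  where "cadjoint A \<equiv> adjoint_on UNIV cinner cinner A"

definition orth_proj :: "('a::ab_group_add \<Rightarrow> 'a \<Rightarrow> complex) \<Rightarrow> 'a set \<Rightarrow> 'a \<Rightarrow> 'a"
  where "orth_proj ip M x = (THE y. y \<in> M \<and> (\<forall>m\<in>M. ip (x - y) m = 0))"

definition suminf_on :: "'a::ab_group_add set \<Rightarrow> ('a \<Rightarrow> real) \<Rightarrow> (nat \<Rightarrow> 'a) \<Rightarrow> 'a"
  where "suminf_on V nrm a =
    (THE s. s \<in> V \<and> (\<lambda>N. nrm ((\<Sum>n<N. a n) - s)) \<longlonglongrightarrow> 0)"

text \<open>Functionals on \<open>V\<close> are total functions in HOL; to
  have one representative for each of them, they are required to vanish off \<open>V\<close>.\<close>

definition dual_space :: "'a::complex_vector set \<Rightarrow> ('a \<Rightarrow> real) \<Rightarrow> ('a \<Rightarrow> complex) set"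
  where "dual_space V nrm =
    {\<phi>. (\<forall>f\<in>V. \<forall>g\<in>V. \<phi> (f + g) = \<phi> f + \<phi> g) \<and>
        (\<forall>c. \<forall>f\<in>V. \<phi> (c *\<^sub>C f) = c * \<phi> f) \<and>
        (\<exists>K. \<forall>f\<in>V. cmod (\<phi> f) \<le> K * nrm f) \<and>
        (\<forall>f. f \<notin> V \<longrightarrow> \<phi> f = 0)}"

definition dual_norm :: "'a set \<Rightarrow> ('a \<Rightarrow> real) \<Rightarrow> ('a \<Rightarrow> complex) \<Rightarrow> real"
  where "dual_norm V nrm \<phi> = (SUP f\<in>{f \<in> V. nrm f \<le> 1}. cmod (\<phi> f))"


section \<open>Left-invertible operators and their analytic models\<close>

definition left_invertible :: "('h::chilbert_space \<Rightarrow> 'h) \<Rightarrow> bool"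
  where "left_invertible T \<longleftrightarrow> (\<exists>S. bounded_clinear S \<and> S \<circ> T = id)"

definition cauchy_dual :: "('h::chilbert_space \<Rightarrow> 'h) \<Rightarrow> 'h \<Rightarrow> 'h"
  where "cauchy_dual T = T \<circ> inv (cadjoint T \<circ> T)"

text \<open>The outer radius may be infinite.\<close>

definition annulus :: "real \<Rightarrow> ereal \<Rightarrow> complex set"
  where "annulus a b = {z. a < cmod z \<and> ereal (cmod z) < b}"

text \<open>Functions on an annulus \<open>A\<close> are total functions that vanish off \<open>A\<close>; they are thus determined
  by their values on \<open>A\<close>, and the pointwise vector space operations of the function type are the
  operations on functions on \<open>A\<close>.

  With \<open>S\<close> the adjoint of the Cauchy dual of \<open>T\<close>, \<open>laurent_model E \<Omega> T S x\<close> is \<open>U\<^sub>x\<close>; with \<open>T'\<close> the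
  Cauchy dual and \<open>T\<^sup>*\<close> the adjoint, \<open>laurent_model E \<Omega>' T' T\<^sup>* x\<close> is \<open>U'\<^sub>x\<close>.\<close>

definition laurent_model :: "'h::chilbert_space set \<Rightarrow> complex set \<Rightarrow> ('h \<Rightarrow> 'h) \<Rightarrow> ('h \<Rightarrow> 'h)
    \<Rightarrow> 'h \<Rightarrow> complex \<Rightarrow> 'h"
  where "laurent_model E A R S x z =
    (if z \<in> A
     then (\<Sum>n. (1 / z ^ Suc n) *\<^sub>C orth_proj cinner E ((R ^^ Suc n) x))
        + (\<Sum>n. (z ^ n) *\<^sub>C orth_proj cinner E ((S ^^ n) x))
     else 0)"

definition laurent_convergent :: "'h::chilbert_space set \<Rightarrow> complex set \<Rightarrow> ('h \<Rightarrow> 'h) \<Rightarrow> ('h \<Rightarrow> 'h)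
    \<Rightarrow> 'h \<Rightarrow> bool"
  where "laurent_convergent E A R S x \<longleftrightarrow>
    (\<forall>z\<in>A. summable (\<lambda>n. (1 / z ^ Suc n) *\<^sub>C orth_proj cinner E ((R ^^ Suc n) x))
         \<and> summable (\<lambda>n. (z ^ n) *\<^sub>C orth_proj cinner E ((S ^^ n) x)))"

text \<open>Inner product and norm on the range of an injective map \<open>U\<close> that make \<open>U\<close> unitary.\<close>

definition induced_inner :: "('h::chilbert_space \<Rightarrow> 'f) \<Rightarrow> 'f \<Rightarrow> 'f \<Rightarrow> complex"
  where "induced_inner U f g = cinner (inv U f) (inv U g)"

definition induced_norm :: "('h::chilbert_space \<Rightarrow> 'f) \<Rightarrow> 'f \<Rightarrow> real"
  where "induced_norm U f = norm (inv U f)"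

definition mult_z :: "(complex \<Rightarrow> 'h::complex_vector) \<Rightarrow> complex \<Rightarrow> 'h"
  where "mult_z f = (\<lambda>z. z *\<^sub>C f z)"

text \<open>The division by \<open>z\<close> is harmless at \<open>z = 0\<close>, which never lies in an annulus.\<close>

definition mult_z_left_inverse :: "(complex \<Rightarrow> 'h::complex_vector) set
    \<Rightarrow> ((complex \<Rightarrow> 'h) \<Rightarrow> (complex \<Rightarrow> 'h) \<Rightarrow> complex) \<Rightarrow> (complex \<Rightarrow> 'h) \<Rightarrow> complex \<Rightarrow> 'h"
  where "mult_z_left_inverse V ip f =
    (\<lambda>z. (1 / z) *\<^sub>C (f z - orth_proj ip {g \<in> V. adjoint_on V ip ip mult_z g = 0} f z))"

text \<open>The operator \<open>\<Psi>(w)\<close>, where \<open>\<iota>\<close> is the identification of \<open>e\<close> with an element of \<open>V\<close>.\<close>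

definition psi_map :: "'f::complex_vector set \<Rightarrow> ('f \<Rightarrow> real) \<Rightarrow> ('f \<Rightarrow> 'f) \<Rightarrow> ('f \<Rightarrow> 'f) \<Rightarrow> ('e \<Rightarrow> 'f)
    \<Rightarrow> complex \<Rightarrow> 'e \<Rightarrow> 'f"
  where "psi_map V nrm L M \<iota> w e =
    suminf_on V nrm (\<lambda>n. (1 / w ^ Suc n) *\<^sub>C ((L ^^ Suc n) (\<iota> e)))
    + suminf_on V nrm (\<lambda>n. (w ^ n) *\<^sub>C ((M ^^ n) (\<iota> e)))"

text \<open>The map \<open>\<U>\<close> from the dual space to \<open>E\<close>-valued functions on \<open>A\<close>, and the norm that it induces
  on its image, the Cauchy dual space.\<close>

definition dual_map :: "'h::chilbert_space set \<Rightarrow> complex set \<Rightarrow> (complex \<Rightarrow> 'h \<Rightarrow> 'f)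
    \<Rightarrow> ('f \<Rightarrow> complex) \<Rightarrow> complex \<Rightarrow> 'h"
  where "dual_map E A \<Psi> \<phi> w =
    (if w \<in> A then (THE v. v \<in> E \<and> (\<forall>e\<in>E. \<phi> (\<Psi> (cnj w) e) = cinner e v)) else 0)"

definition cauchy_dual_space :: "'h::chilbert_space set \<Rightarrow> complex set \<Rightarrow> 'f::complex_vector set
    \<Rightarrow> ('f \<Rightarrow> real) \<Rightarrow> (complex \<Rightarrow> 'h \<Rightarrow> 'f) \<Rightarrow> (complex \<Rightarrow> 'h) set"
  where "cauchy_dual_space E A V nrm \<Psi> = dual_map E A \<Psi> ` dual_space V nrm"

definition cauchy_dual_norm :: "'h::chilbert_space set \<Rightarrow> complex set \<Rightarrow> 'f::complex_vector set
    \<Rightarrow> ('f \<Rightarrow> real) \<Rightarrow> (complex \<Rightarrow> 'h \<Rightarrow> 'f) \<Rightarrow> (complex \<Rightarrow> 'h) \<Rightarrow> real"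
  where "cauchy_dual_norm E A V nrm \<Psi> h =
    dual_norm V nrm (inv_into (dual_space V nrm) (dual_map E A \<Psi>) h)"

end

theory Submission
  imports Defs "HOL-Complex_Analysis.Cauchy_Integral_Formula"
begin

text \<open>Write \<open>T\<^sup>*\<close> and \<open>T'\<^sup>*\<close> for the two adjoints. Both \<open>U\<close> and \<open>U'\<close> are Laurent models of one
  kind: for a pair of operators \<open>(R, S)\<close> the coefficients of the model of \<open>x\<close> are \<open>P\<^sub>E R\<^sup>n x\<close> and
  \<open>P\<^sub>E S\<^sup>n x\<close>, with \<open>(R, S) = (T, T'\<^sup>*)\<close> for \<open>U\<close> and \<open>(R, S) = (T', T\<^sup>*)\<close> for \<open>U'\<close>. The locale
  \<open>laurent_setting\<close> treats both at once.

  The model map is injective: if the model of \<open>x\<close> vanishes, then all its coefficients vanish by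
  uniqueness of Laurent expansions (\<open>laurent_series_zero_coeffs\<close>), so that \<open>x\<close> is orthogonal to
  the images of \<open>E\<close> under the powers of \<open>R\<^sup>*\<close> and \<open>S\<^sup>*\<close>, which span a dense subspace. Hence
  \<open>U\<close> transports the Hilbert space structure to \<open>\<H>\<close>. It turns \<open>T\<close> into multiplication by \<open>z\<close>,
  because \<open>T'\<^sup>* T = 1\<close>, and \<open>T'\<^sup>*\<close> into \<open>\<L>\<close>, because \<open>1 - T T'\<^sup>*\<close> is the orthogonal
  projection onto the kernel of \<open>T\<^sup>*\<close>. Therefore
  \<open>\<Psi> (cnj w) e = U (\<Sum>\<^sub>n\<^sub>\<ge>\<^sub>1 cnj w\<^sup>-\<^sup>n T'\<^sup>*\<^sup>n e + \<Sum>\<^sub>n\<^sub>\<ge>\<^sub>0 cnj w\<^sup>n T\<^sup>n e)\<close>.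

  These series live on the side of the adjoints, where only the convergence of \<open>U'\<^sub>x\<close> for every
  \<open>x\<close> is known. That makes their terms weakly bounded on every circle in the annulus \<open>\<Omega>'\<close>; the
  uniform boundedness principle makes them bounded in norm, and comparison with a geometric series
  on a neighbouring circle gives norm convergence
  (\<open>summable_adjoint_principal\<close>, \<open>summable_adjoint_regular\<close>).

  Moving the operators across the inner product now gives, for \<open>\<phi> = \<langle>\<cdot>, U y\<rangle>\<close>,
  \<open>\<phi> (\<Psi> (cnj w) e) = \<langle>e, U'\<^sub>y w\<rangle>\<close>, that is, \<open>\<U> \<phi> = U' y\<close>. By the Riesz representation theorem
  every functional has this form, and \<open>\<phi>\<close> has norm \<open>\<parallel>y\<parallel>\<close>, which is the norm of \<open>U' y\<close> since
  \<open>U'\<close> is injective as well.\<close>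

section \<open>Geometry of complex Hilbert spaces\<close>

instance chilbert_space \<subseteq> banach ..

lemma cinner_add_right: "cinner x (y + z) = cinner x y + cinner x (z::'a::complex_inner)"
  by (metis cinner_add_left cinner_commute complex_cnj_add)

lemma cinner_scaleC_right: "cinner x (c *\<^sub>C y) = cnj c * cinner x (y::'a::complex_inner)"
  by (metis cinner_commute cinner_scaleC_left complex_cnj_mult)

lemma cinner_zero_left [simp]: "cinner 0 (y::'a::complex_inner) = 0"
  using cinner_add_left[of 0 0 y] by simp

lemma cinner_zero_right [simp]: "cinner (x::'a::complex_inner) 0 = 0"
  using cinner_add_right[of x 0 0] by simp

lemma cinner_diff_left: "cinner (x - y) z = cinner x z - cinner y (z::'a::complex_inner)"
  using cinner_add_left[of "x - y" y z] by simp

lemma cinner_diff_right: "cinner x (y - z) = cinner x y - cinner x (z::'a::complex_inner)"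
  using cinner_add_right[of x "y - z" z] by simp

lemma cinner_eq_zero_sym: "cinner x y = 0 \<longleftrightarrow> cinner y (x::'a::complex_inner) = 0"
  by (metis cinner_commute complex_cnj_zero_iff)

lemma cinner_self_eq_zero [simp]: "cinner x x = 0 \<longleftrightarrow> (x::'a::complex_inner) = 0"
  by (simp add: cinner_self)

lemma cinner_ext_right: "(\<And>x. cinner x y = cinner x z) \<Longrightarrow> y = (z::'a::complex_inner)"
  using cinner_self_eq_zero[of "y - z"] by (simp add: cinner_diff_right)

lemma cinner_ext_left: "(\<And>x. cinner y x = cinner z x) \<Longrightarrow> y = (z::'a::complex_inner)"
  using cinner_self_eq_zero[of "y - z"] by (simp add: cinner_diff_left)

lemma norm_scaleC: "norm (c *\<^sub>C x) = cmod c * norm (x::'a::complex_inner)"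
proof -
  have "complex_of_real ((norm (c *\<^sub>C x))\<^sup>2) = c * (cnj c * complex_of_real ((norm x)\<^sup>2))"
    by (simp only: cinner_self[symmetric] cinner_scaleC_left cinner_scaleC_right mult.left_commute)
  also have "\<dots> = complex_of_real ((cmod c * norm x)\<^sup>2)"
    by (simp add: complex_norm_square power_mult_distrib mult.assoc del: of_real_power)
  finally have "(norm (c *\<^sub>C x))\<^sup>2 = (cmod c * norm x)\<^sup>2"
    by (simp only: of_real_eq_iff)
  then show ?thesis
    by (simp add: power2_eq_iff_nonneg)
qed

text \<open>Subtracting from \<open>h\<close> its component along \<open>m\<close> shortens it by exactly the size of that component.
  The Cauchy--Schwarz inequality expresses that the right-hand side is nonnegative; in the
  projection theorem the identity shows that a vector which cannot be shortened along \<open>m\<close> is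
  orthogonal to \<open>m\<close>.\<close>

lemma norm_diff_projection_sq:
  fixes h m :: "'a::complex_inner"
  assumes "m \<noteq> 0"
  shows "(norm (h - (cinner h m / cinner m m) *\<^sub>C m))\<^sup>2
    = (norm h)\<^sup>2 - (cmod (cinner h m))\<^sup>2 / (norm m)\<^sup>2"
proof -
  let ?c = "cinner h m / cinner m m"
  have "complex_of_real ((norm (h - ?c *\<^sub>C m))\<^sup>2) = cinner h h - cnj ?c * cinner h m"
    using assms unfolding cinner_self[symmetric]
    by (simp add: cinner_diff_left cinner_diff_right cinner_scaleC_left cinner_scaleC_right
        cinner_commute[of m h] cinner_commute[of m m, symmetric] algebra_simps)
  also have "\<dots> = complex_of_real ((norm h)\<^sup>2 - (cmod (cinner h m))\<^sup>2 / (norm m)\<^sup>2)"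
    unfolding cinner_self of_real_diff of_real_divide complex_norm_square by simp
  finally show ?thesis
    by (simp only: of_real_eq_iff)
qed

lemma cmod_cinner_le: "cmod (cinner x y) \<le> norm x * norm (y::'a::complex_inner)"
proof (cases "y = 0")
  case False
  have "(cmod (cinner x y))\<^sup>2 / (norm y)\<^sup>2 \<le> (norm x)\<^sup>2"
    using norm_diff_projection_sq[OF False, of x]
    by (metis diff_ge_0_iff_ge zero_le_power2)
  then have "(cmod (cinner x y))\<^sup>2 \<le> (norm x * norm y)\<^sup>2"
    using False by (simp add: divide_simps power_mult_distrib)
  then show ?thesis
    by (rule power2_le_imp_le) simp
qed simp

lemma bounded_linear_cinner_left: "bounded_linear (\<lambda>x. cinner x (y::'a::complex_inner))"
proof (rule bounded_linear_intro[where K = "norm y"])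
  show "cinner (r *\<^sub>R x) y = r *\<^sub>R cinner x y" for r x
    by (simp add: scaleR_scaleC cinner_scaleC_left scaleR_conv_of_real)
qed (auto simp: cinner_add_left cmod_cinner_le)

lemma bounded_linear_cinner_right: "bounded_linear (\<lambda>y. cinner (x::'a::complex_inner) y)"
proof (rule bounded_linear_intro[where K = "norm x"])
  show "cinner x (r *\<^sub>R y) = r *\<^sub>R cinner x y" for r y
    by (simp add: scaleR_scaleC cinner_scaleC_right scaleR_conv_of_real)
qed (auto simp: cinner_add_right cmod_cinner_le mult.commute[of "norm _" "norm x"])

lemma bounded_linear_scaleC: "bounded_linear (\<lambda>x::'a::complex_inner. c *\<^sub>C x)"
proof (rule bounded_linear_intro[where K = "cmod c"])
  show "c *\<^sub>C r *\<^sub>R x = r *\<^sub>R c *\<^sub>C x" for r and x :: 'a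
    by (simp add: scaleR_scaleC scaleC_scaleC mult.commute)
qed (auto simp: scaleC_add_right norm_scaleC)

lemma parallelogram_law:
  "(norm (x + y))\<^sup>2 + (norm (x - y))\<^sup>2 = 2 * (norm x)\<^sup>2 + 2 * (norm (y::'a::complex_inner))\<^sup>2"
proof -
  have "complex_of_real ((norm (x + y))\<^sup>2 + (norm (x - y))\<^sup>2)
    = complex_of_real (2 * (norm x)\<^sup>2 + 2 * (norm y)\<^sup>2)"
    unfolding of_real_add of_real_mult cinner_self[symmetric]
    by (simp add: cinner_diff_left cinner_diff_right cinner_add_left cinner_add_right)
  then show ?thesis
    by (simp only: of_real_eq_iff)
qed

lemma csubspace_simps:
  assumes "csubspace (E::'a::complex_vector set)"
  shows "0 \<in> E" "x \<in> E \<Longrightarrow> y \<in> E \<Longrightarrow> x + y \<in> E" "x \<in> E \<Longrightarrow> c *\<^sub>C x \<in> E"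
    "x \<in> E \<Longrightarrow> y \<in> E \<Longrightarrow> x - y \<in> E"
  using assms complex_vector.subspace_diff
  by (auto simp: complex_vector.subspace_def)

text \<open>Let \<open>d\<close> be the distance from \<open>x\<close> to \<open>M\<close>. A minimising sequence is Cauchy: midpoints of its
  members stay in \<open>M\<close> and hence at distance at least \<open>d\<close> from \<open>x\<close>, so that the parallelogram law
  bounds the distance between the members. At the limit \<open>p\<close>, moving along any \<open>m \<in> M\<close> cannot
  shorten \<open>x - p\<close>, and \<open>norm_diff_projection_sq\<close> makes \<open>x - p\<close> orthogonal to \<open>m\<close>.\<close>

lemma orthogonal_projection_exists:
  fixes M :: "'a::chilbert_space set"
  assumes M: "csubspace M" "closed M"
  obtains y where "y \<in> M" "\<And>m. m \<in> M \<Longrightarrow> cinner (x - y) m = 0"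
proof -
  note sub = csubspace_simps[OF M(1)]
  define d where "d = infdist x M"
  have ne: "M \<noteq> {}" using sub(1) by blast
  have d: "d \<ge> 0" "\<And>y. y \<in> M \<Longrightarrow> d \<le> norm (x - y)"
    unfolding d_def by (auto simp: infdist_nonneg infdist_le simp flip: dist_norm)
  have "\<exists>y\<in>M. norm (x - y) < d + 1 / real (Suc n)" for n
  proof -
    have "\<exists>y\<in>M. dist x y < d + 1 / real (Suc n)"
    proof (rule ccontr)
      assume "\<not> ?thesis"
      then have "d + 1 / real (Suc n) \<le> infdist x M"
        using ne unfolding infdist_def by (auto intro!: cINF_greatest simp: not_less)
      then show False unfolding d_def by simp
    qed
    then show ?thesis by (simp add: dist_norm)
  qed
  then obtain y where y: "\<And>n. y n \<in> M" "\<And>n. norm (x - y n) < d + 1 / real (Suc n)"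
    by metis
  have lim: "(\<lambda>n. norm (x - y n)) \<longlonglongrightarrow> d"
  proof (rule tendsto_sandwich[OF _ _ tendsto_const])
    show "\<forall>\<^sub>F n in sequentially. norm (x - y n) \<le> d + 1 / real (Suc n)"
      using y(2) by (auto intro: always_eventually less_imp_le)
    show "(\<lambda>n. d + 1 / real (Suc n)) \<longlonglongrightarrow> d"
      using tendsto_add[OF tendsto_const[of d] LIMSEQ_inverse_real_of_nat]
      by (simp add: inverse_eq_divide)
  qed (use d y(1) in \<open>auto intro: always_eventually\<close>)
  have sq: "(norm (y m - y n))\<^sup>2 \<le> 2 * (norm (x - y m))\<^sup>2 + 2 * (norm (x - y n))\<^sup>2 - 4 * d\<^sup>2" for m n
  proof -
    have mid: "(1/2) *\<^sub>C (y m + y n) \<in> M"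
      using sub y(1) by blast
    have "(x - y m) + (x - y n) = 2 *\<^sub>R (x - (1/2) *\<^sub>C (y m + y n))"
      by (simp add: scaleR_scaleC scaleC_add_right complex_vector.scale_right_diff_distrib
          scaleC_scaleC scaleC_one scaleC_add_left[of 1 1 x, simplified])
    then have "norm ((x - y m) + (x - y n)) = 2 * norm (x - (1/2) *\<^sub>C (y m + y n))"
      by (simp only: norm_scaleR abs_numeral)
    with d(2)[OF mid] have "2 * d \<le> norm ((x - y m) + (x - y n))"
      by simp
    then have "(2 * d)\<^sup>2 \<le> (norm ((x - y m) + (x - y n)))\<^sup>2"
      using d(1) by (intro power_mono) auto
    moreover have "norm ((x - y m) - (x - y n)) = norm (y m - y n)"
      by (simp add: norm_minus_commute)
    ultimately show ?thesis
      using parallelogram_law[of "x - y m" "x - y n"] by (simp add: power_mult_distrib)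
  qed
  have "Cauchy y"
  proof (rule CauchyI)
    fix e :: real
    assume e: "0 < e"
    have "(\<lambda>n. (norm (x - y n))\<^sup>2) \<longlonglongrightarrow> d\<^sup>2"
      by (intro tendsto_power lim)
    from LIMSEQ_D[OF this, of "e\<^sup>2 / 4"] e obtain N
      where N: "\<And>n. n \<ge> N \<Longrightarrow> \<bar>(norm (x - y n))\<^sup>2 - d\<^sup>2\<bar> < e\<^sup>2 / 4"
      by auto
    have "norm (y m - y n) < e" if "m \<ge> N" "n \<ge> N" for m n
    proof -
      have "(norm (y m - y n))\<^sup>2 < e\<^sup>2"
        using sq[of m n] N[OF that(1)] N[OF that(2)] by linarith
      then show ?thesis using e by (simp add: power2_less_imp_less)
    qed
    then show "\<exists>N. \<forall>m\<ge>N. \<forall>n\<ge>N. norm (y m - y n) < e" by blast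
  qed
  then obtain p where p: "y \<longlonglongrightarrow> p"
    using Cauchy_convergent convergent_def by blast
  have pM: "p \<in> M"
    using M(2) p y(1) closed_sequentially by blast
  have "(\<lambda>n. norm (x - y n)) \<longlonglongrightarrow> norm (x - p)"
    by (intro tendsto_intros p)
  then have nd: "norm (x - p) = d"
    using lim LIMSEQ_unique by blast
  have "cinner (x - p) m = 0" if m: "m \<in> M" for m
  proof (cases "m = 0")
    case False
    let ?c = "cinner (x - p) m / cinner m m"
    have "p + ?c *\<^sub>C m \<in> M"
      using sub pM m by blast
    then have "d \<le> norm (x - p - ?c *\<^sub>C m)"
      using d(2) by (metis diff_diff_add)
    then have "d\<^sup>2 \<le> (norm (x - p - ?c *\<^sub>C m))\<^sup>2"
      using d(1) by (simp add: power_mono)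
    then have "(cmod (cinner (x - p) m))\<^sup>2 / (norm m)\<^sup>2 \<le> 0"
      unfolding norm_diff_projection_sq[OF False] nd by simp
    then show ?thesis
      using False by (simp add: divide_le_0_iff)
  qed simp
  with pM that show thesis by blast
qed

lemma orth_proj_eqI:
  fixes M :: "'a::complex_inner set"
  assumes M: "csubspace M" and y: "y \<in> M" "\<And>m. m \<in> M \<Longrightarrow> cinner (x - y) m = 0"
  shows "orth_proj cinner M x = y"
  unfolding orth_proj_def
proof (rule the_equality)
  fix y'
  assume y': "y' \<in> M \<and> (\<forall>m\<in>M. cinner (x - y') m = 0)"
  have "y - y' \<in> M"
    using csubspace_simps[OF M] y y' by blast
  then have "cinner (x - y') (y - y') - cinner (x - y) (y - y') = 0"
    using y y' by auto
  then have "cinner (y - y') (y - y') = 0"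
    by (simp add: cinner_diff_left)
  then show "y' = y" by simp
qed (use y in auto)

lemma
  fixes M :: "'a::chilbert_space set"
  assumes M: "csubspace M" "closed M"
  shows orth_proj_in: "orth_proj cinner M x \<in> M"
    and cinner_orth_proj: "m \<in> M \<Longrightarrow> cinner (orth_proj cinner M x) m = cinner x m"
proof -
  obtain y where y: "y \<in> M" "\<And>m. m \<in> M \<Longrightarrow> cinner (x - y) m = 0"
    by (rule orthogonal_projection_exists[OF M, of x]) blast
  then have "orth_proj cinner M x = y"
    by (rule orth_proj_eqI[OF M(1)])
  with y show "orth_proj cinner M x \<in> M" "m \<in> M \<Longrightarrow> cinner (orth_proj cinner M x) m = cinner x m"
    by (auto simp: cinner_diff_left)
qed

lemma orth_proj_add:
  fixes M :: "'a::chilbert_space set"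
  assumes M: "csubspace M" "closed M"
  shows "orth_proj cinner M (x + y) = orth_proj cinner M x + orth_proj cinner M y"
  by (rule orth_proj_eqI[OF M(1)])
    (auto simp: csubspace_simps[OF M(1)] orth_proj_in[OF M] cinner_orth_proj[OF M]
      cinner_diff_left cinner_add_left)

lemma orth_proj_scaleC:
  fixes M :: "'a::chilbert_space set"
  assumes M: "csubspace M" "closed M"
  shows "orth_proj cinner M (c *\<^sub>C x) = c *\<^sub>C orth_proj cinner M x"
  by (rule orth_proj_eqI[OF M(1)])
    (auto simp: csubspace_simps[OF M(1)] orth_proj_in[OF M] cinner_orth_proj[OF M]
      cinner_diff_left cinner_scaleC_left)

definition clinear :: "('a::complex_vector \<Rightarrow> 'b::complex_vector) \<Rightarrow> bool"
  where "clinear f \<longleftrightarrow> (\<forall>x y. f (x + y) = f x + f y) \<and> (\<forall>c x. f (c *\<^sub>C x) = c *\<^sub>C f x)"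

lemma clinear_zero: "clinear f \<Longrightarrow> f 0 = 0"
  unfolding clinear_def by (metis add_cancel_right_right)

lemma clinear_diff: "clinear f \<Longrightarrow> f (x - y) = f x - f y"
  unfolding clinear_def by (metis add_diff_cancel diff_add_cancel)

text \<open>The orthogonal complement of the kernel of \<open>\<phi>\<close> is spanned by a single vector \<open>z\<close>: whenever
  \<open>x\<close> is given, \<open>\<phi> z x - \<phi> x z\<close> lies in the kernel, and pairing it with \<open>z\<close> expresses \<open>\<phi> x\<close>
  as an inner product with a multiple of \<open>z\<close>.\<close>

lemma riesz_representation:
  fixes \<phi> :: "'a::chilbert_space \<Rightarrow> complex"
  assumes add: "\<And>x y. \<phi> (x + y) = \<phi> x + \<phi> y" and scale: "\<And>c x. \<phi> (c *\<^sub>C x) = c * \<phi> x"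
    and bd: "\<And>x. cmod (\<phi> x) \<le> K * norm x"
  obtains y where "\<And>x. \<phi> x = cinner x y"
proof (cases "\<forall>x. \<phi> x = 0")
  case True
  then show thesis using that[of 0] by simp
next
  case False
  then obtain u where u: "\<phi> u \<noteq> 0" by blast
  define M where "M = {x. \<phi> x = 0}"
  have diff: "\<phi> (x - y) = \<phi> x - \<phi> y" for x y
    using add[of "x - y" y] by simp
  have zero: "\<phi> 0 = 0" using diff[of 0 0] by simp
  have M: "csubspace M"
    unfolding complex_vector.subspace_def M_def by (simp add: add scale zero)
  have "bounded_linear \<phi>"
    using bd by (intro bounded_linear_intro[where K = K])
      (auto simp: add scale scaleR_scaleC scaleR_conv_of_real mult.commute)
  then have "closed M"
    unfolding M_def
    by (intro closed_Collect_eq continuous_on_const linear_continuous_on)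
  note M = M this
  obtain p where p: "p \<in> M" "\<And>m. m \<in> M \<Longrightarrow> cinner (u - p) m = 0"
    by (rule orthogonal_projection_exists[OF M, of u]) blast
  define z where "z = u - p"
  have z: "\<phi> z = \<phi> u" "cinner z z \<noteq> 0"
    using p(1) u by (auto simp: z_def diff M_def)
  have "\<phi> x = cinner x (cnj (\<phi> z / cinner z z) *\<^sub>C z)" for x
  proof -
    have "\<phi> z *\<^sub>C x - \<phi> x *\<^sub>C z \<in> M"
      by (simp add: M_def diff scale)
    then have "cinner (\<phi> z *\<^sub>C x - \<phi> x *\<^sub>C z) z = 0"
      using p(2) cinner_eq_zero_sym unfolding z_def by blast
    then have "\<phi> z * cinner x z = \<phi> x * cinner z z"
      by (simp add: cinner_diff_left cinner_scaleC_left)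
    then show ?thesis
      using z(2) by (simp add: cinner_scaleC_right field_simps)
  qed
  then show thesis using that by blast
qed

lemma orthogonal_total_eq_zero:
  fixes x :: "'a::complex_inner"
  assumes tot: "closure (cspan B) = UNIV" and orth: "\<And>y. y \<in> B \<Longrightarrow> cinner x y = 0"
  shows "x = 0"
proof -
  have "cinner x y = 0" if "y \<in> cspan B" for y
    using that
    by (induction rule: complex_vector.span_induct_alt)
      (auto simp: cinner_add_right cinner_scaleC_right orth)
  then have "cspan B \<subseteq> {y. cinner x y = 0}" by blast
  moreover have "closed {y. cinner x y = 0}"
    by (intro closed_Collect_eq continuous_on_const linear_continuous_on bounded_linear_cinner_right)
  ultimately have "closure (cspan B) \<subseteq> {y. cinner x y = 0}"
    by (rule closure_minimal)
  then have "cinner x x = 0" using tot by blast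
  then show ?thesis by simp
qed

lemmas suminf_scaleC = bounded_linear.suminf[OF bounded_linear_scaleC]
lemmas summable_cinner_left = bounded_linear.summable[OF bounded_linear_cinner_left]
lemmas suminf_cinner_left = bounded_linear.suminf[OF bounded_linear_cinner_left]
lemmas suminf_cinner_right = bounded_linear.suminf[OF bounded_linear_cinner_right]

lemma csubspace_suminf:
  fixes E :: "'a::complex_inner set"
  assumes E: "csubspace E" "closed E" and v: "\<And>n. v n \<in> E" "summable v"
  shows "suminf v \<in> E"
proof -
  have "\<And>N. (\<Sum>n<N. v n) \<in> E"
    by (rule complex_vector.subspace_sum[OF E(1)]) (rule v(1))
  then show ?thesis
    by (rule closed_sequentially[OF E(2)]) (rule summable_LIMSEQ[OF v(2)])
qed

section \<open>Adjoints\<close>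

text \<open>A relation rather than an operator, because the adjoint of the Cauchy dual is found as an
  explicit operator and then only has to be verified, and because the relation passes to
  compositions and powers one factor at a time.\<close>

definition adjoint_pair :: "('a::complex_inner \<Rightarrow> 'b::complex_inner) \<Rightarrow> ('b \<Rightarrow> 'a) \<Rightarrow> bool"
  where "adjoint_pair A B \<longleftrightarrow> (\<forall>x y. cinner (A x) y = cinner x (B y))"

lemma adjoint_pairD: "adjoint_pair A B \<Longrightarrow> cinner (A x) y = cinner x (B y)"
  by (simp add: adjoint_pair_def)

lemma adjoint_pair_sym: "adjoint_pair A B \<Longrightarrow> adjoint_pair B A"
  unfolding adjoint_pair_def by (metis cinner_commute)

lemma adjoint_pair_comp: "adjoint_pair A B \<Longrightarrow> adjoint_pair C D \<Longrightarrow> adjoint_pair (A \<circ> C) (D \<circ> B)"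
  by (simp add: adjoint_pair_def)

lemma adjoint_pair_funpow:
  fixes A B :: "'a::complex_inner \<Rightarrow> 'a"
  shows "adjoint_pair A B \<Longrightarrow> adjoint_pair (A ^^ n) (B ^^ n)"
proof (induction n)
  case (Suc n)
  then have "adjoint_pair (A \<circ> A ^^ n) (B ^^ n \<circ> B)"
    by (intro adjoint_pair_comp)
  then show ?case
    unfolding funpow.simps(2)[of n A] funpow_Suc_right[of n B] .
qed (simp add: adjoint_pair_def)

lemma adjoint_pair_clinear:
  assumes "adjoint_pair A B"
  shows "clinear A"
  unfolding clinear_def
proof (intro conjI allI)
  show "A (x + y) = A x + A y" for x y
    by (rule cinner_ext_left) (simp add: adjoint_pairD[OF assms] cinner_add_left)
  show "A (c *\<^sub>C x) = c *\<^sub>C A x" for c x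
    by (rule cinner_ext_left) (simp add: adjoint_pairD[OF assms] cinner_scaleC_left)
qed

lemma cadjoint_eqI:
  assumes "adjoint_pair A B"
  shows "cadjoint A = B"
proof
  fix w
  show "cadjoint A w = B w"
    unfolding adjoint_on_def
  proof (rule the_equality)
    fix v
    assume "v \<in> UNIV \<and> (\<forall>x\<in>UNIV. cinner (A x) w = cinner x v)"
    then show "v = B w"
      by (intro cinner_ext_right) (simp add: adjoint_pairD[OF assms])
  qed (simp add: adjoint_pairD[OF assms])
qed

lemma adjoint_pair_cadjoint:
  assumes "bounded_clinear (A::'a::chilbert_space \<Rightarrow> 'b::chilbert_space)"
  shows "adjoint_pair A (cadjoint A)"
proof -
  have "bounded_linear A \<and> (\<forall>c x. A (c *\<^sub>C x) = c *\<^sub>C A x)"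
    using assms unfolding bounded_clinear_def .
  then have bl: "bounded_linear A" and sc: "\<And>c x. A (c *\<^sub>C x) = c *\<^sub>C A x"
    by blast+
  obtain K where K: "\<And>x. norm (A x) \<le> norm x * K"
    using bounded_linear.bounded[OF bl] by blast
  have "\<exists>v. \<forall>x. cinner (A x) w = cinner x v" for w
  proof -
    have bd: "cmod (cinner (A x) w) \<le> (K * norm w) * norm x" for x
      using order_trans[OF cmod_cinner_le mult_right_mono[OF K norm_ge_zero]]
      by (simp add: mult_ac)
    obtain v where "\<And>x. cinner (A x) w = cinner x v"
      by (rule riesz_representation[of "\<lambda>x. cinner (A x) w" "K * norm w"])
        (use bd in \<open>auto simp: linear_simps(1)[OF bl] sc cinner_add_left cinner_scaleC_left\<close>)
    then show ?thesis by blast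
  qed
  then obtain B where B: "adjoint_pair A B"
    unfolding adjoint_pair_def by metis
  then show ?thesis by (simp add: cadjoint_eqI[OF B])
qed

section \<open>Uniform boundedness\<close>

text \<open>The sets on which the family is bounded by \<open>N\<close> are closed and cover the space, so that by
  Baire's theorem one of them contains a ball; by linearity a bound on one ball is a bound
  everywhere.\<close>

lemma uniform_boundedness:
  fixes f :: "'i \<Rightarrow> 'a::banach \<Rightarrow> 'b::real_normed_vector"
  assumes bl: "\<And>i. bounded_linear (f i)" and pt: "\<And>x. \<exists>C. \<forall>i. norm (f i x) \<le> C"
  obtains K where "\<And>i x. norm (f i x) \<le> K * norm x"
proof -
  define F where "F N = {x. \<forall>i. norm (f i x) \<le> real N}" for N :: nat
  have F: "closed (F N)" for N
    unfolding F_def Collect_all_eq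
    by (intro closed_INT ballI closed_Collect_le continuous_intros
        linear_continuous_on bl)
  have cov: "\<Union>(range F) = UNIV"
  proof -
    have "\<exists>N. x \<in> F N" for x
    proof -
      obtain C where "\<forall>i. norm (f i x) \<le> C" using pt by blast
      moreover obtain N :: nat where "C \<le> real N" using real_arch_simple by blast
      ultimately show ?thesis unfolding F_def by (auto intro: order_trans)
    qed
    then show ?thesis by auto
  qed
  have cm: "completely_metrizable_space (euclidean :: 'a topology)"
    using completely_metrizable_space_euclidean .
  have "\<exists>N. interior (F N) \<noteq> {}"
  proof (rule ccontr)
    assume "\<not> ?thesis"
    then have "euclidean interior_of \<Union>(range F) = {}"
      using cm F by (intro Baire_category_alt) auto
    then show False by (simp add: cov)
  qed
  then obtain N x0 where "x0 \<in> interior (F N)" by blast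
  then obtain r where r: "r > 0" "cball x0 r \<subseteq> F N"
    by (auto simp: mem_interior_cball)
  have "norm (f i x) \<le> (2 * real N / r) * norm x" for i x
  proof (cases "x = 0")
    case True
    then show ?thesis by (simp add: linear_simps(3)[OF bl])
  next
    case False
    let ?c = "r / norm x"
    have c: "?c > 0" using r False by simp
    have "x0 + ?c *\<^sub>R x \<in> F N" "x0 \<in> F N"
      using r False by (auto intro!: subsetD[OF r(2)] simp: dist_norm)
    then have "norm (f i (x0 + ?c *\<^sub>R x)) \<le> N" "norm (f i x0) \<le> N"
      by (auto simp: F_def)
    then have "norm (f i (x0 + ?c *\<^sub>R x) - f i x0) \<le> 2 * real N"
      using norm_triangle_ineq4[of "f i (x0 + ?c *\<^sub>R x)" "f i x0"] by linarith
    moreover have "f i (x0 + ?c *\<^sub>R x) - f i x0 = ?c *\<^sub>R f i x"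
      by (simp add: linear_simps[OF bl])
    ultimately have "?c * norm (f i x) \<le> 2 * real N"
      using c by (metis norm_scaleR abs_of_pos)
    then show ?thesis using r False by (simp add: field_simps)
  qed
  then show thesis using that by blast
qed

text \<open>After rescaling by \<open>\<rho>\<^sup>n\<close> the vectors are weakly bounded, hence bounded in norm by uniform
  boundedness; the series is then dominated by a geometric series with ratio \<open>\<bar>w\<bar> / \<rho>\<close>.\<close>

lemma summable_power_scaleC_of_weakly_bounded:
  fixes v :: "nat \<Rightarrow> 'a::chilbert_space"
  assumes wb: "\<And>x. \<exists>C. \<forall>n. cmod (cinner x (v n)) * \<rho> ^ n \<le> C" and w: "cmod w < \<rho>"
  shows "summable (\<lambda>n. w ^ n *\<^sub>C v n)"
proof -
  have \<rho>: "\<rho> > 0" using w by (meson norm_ge_zero order_le_less_trans)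
  define u where "u n = complex_of_real (\<rho> ^ n) *\<^sub>C v n" for n
  have u: "cmod (cinner x (u n)) = cmod (cinner x (v n)) * \<rho> ^ n" for x n
    using \<rho> by (simp add: u_def cinner_scaleC_right norm_mult norm_power)
  obtain K where K: "\<And>n x. norm (cinner x (u n)) \<le> K * norm x"
    by (rule uniform_boundedness[of "\<lambda>n x. cinner x (u n)"])
      (use wb in \<open>auto simp only: u bounded_linear_cinner_left\<close>)
  have nu: "norm (u n) \<le> \<bar>K\<bar>" for n
  proof (cases "u n = 0")
    case False
    have "norm (cinner (u n) (u n)) = norm (u n) * norm (u n)"
      by (simp add: cinner_self power2_eq_square norm_mult)
    then have "norm (u n) * norm (u n) \<le> K * norm (u n)"
      using K[of "u n" n] by (simp only:)
    then have "norm (u n) \<le> K"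
      by (rule mult_right_le_imp_le) (use False in simp)
    then show ?thesis by (rule order_trans) (rule abs_ge_self)
  qed simp
  have le: "norm (w ^ n *\<^sub>C v n) \<le> \<bar>K\<bar> * (cmod w / \<rho>) ^ n" for n
  proof -
    have "norm (w ^ n *\<^sub>C v n) = (cmod w / \<rho>) ^ n * norm (u n)"
      using \<rho> by (simp add: u_def norm_scaleC norm_power norm_mult power_divide)
    also have "\<dots> \<le> (cmod w / \<rho>) ^ n * \<bar>K\<bar>"
      using \<rho> by (intro mult_left_mono nu) auto
    finally show ?thesis by (simp add: mult.commute)
  qed
  have "summable (\<lambda>n. \<bar>K\<bar> * (cmod w / \<rho>) ^ n)"
    using w \<rho> by (intro summable_mult summable_geometric) auto
  then show ?thesis
    by (rule summable_comparison_test'[where N = 0]) (rule le)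
qed

section \<open>Uniqueness of Laurent expansions\<close>

lemma power_series_zero_coeffs:
  fixes a :: "nat \<Rightarrow> complex"
  assumes r: "0 < r" and s: "\<And>z. cmod z < r \<Longrightarrow> (\<lambda>n. a n * z ^ n) sums 0"
  shows "a m = 0"
proof (cases "m = 0")
  case True
  then show ?thesis using s[of 0] r by simp
next
  case False
  show ?thesis
  proof (rule ccontr)
    assume "a m \<noteq> 0"
    show False
    proof (rule powser_0_nonzero[of r 0 a "\<lambda>_. 0" m])
      fix \<delta> :: real
      assume "0 < \<delta>" "\<And>z::complex. z \<in> cball 0 \<delta> - {0} \<Longrightarrow> (0::complex) \<noteq> 0"
      from this(2)[of "of_real \<delta>"] this(1) show False by auto
    qed (use r s False \<open>a m \<noteq> 0\<close> in auto)
  qed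
qed

text \<open>On the annulus the regular part \<open>f\<close> equals minus the principal part \<open>g (1 / z)\<close>. The former
  is holomorphic inside the outer circle, the latter outside the inner circle, and it tends to
  \<open>0\<close> at infinity, so that the two glue to an entire function \<open>F\<close> that vanishes by Liouville's
  theorem. Hence both power series \<open>f\<close> and \<open>g\<close> are zero.\<close>

lemma laurent_series_zero_coeffs:
  fixes a b :: "nat \<Rightarrow> complex"
  assumes st: "0 < s" "s < t"
    and sa: "\<And>z. s \<le> cmod z \<Longrightarrow> cmod z \<le> t \<Longrightarrow> summable (\<lambda>n. 1 / z ^ Suc n * a n)"
    and sb: "\<And>z. s \<le> cmod z \<Longrightarrow> cmod z \<le> t \<Longrightarrow> summable (\<lambda>n. z ^ n * b n)"
    and zero: "\<And>z. s \<le> cmod z \<Longrightarrow> cmod z \<le> t \<Longrightarrow>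
      (\<Sum>n. 1 / z ^ Suc n * a n) + (\<Sum>n. z ^ n * b n) = 0"
  shows "a n = 0" "b n = 0"
proof -
  define f where "f z = (\<Sum>n. b n * z ^ n)" for z
  \<comment> \<open>The principal part as a power series in \<open>1 / z\<close>, without constant term.\<close>
  define a' where "a' n = (case n of 0 \<Rightarrow> 0 | Suc k \<Rightarrow> a k)" for n
  define g where "g w = (\<Sum>n. a' n * w ^ n)" for w
  have f: "(\<lambda>n. b n * z ^ n) sums f z" if "cmod z < t" for z
  proof -
    have "summable (\<lambda>n. b n * (of_real t) ^ n)"
      using sb[of "of_real t"] st by (simp add: mult.commute)
    then have "summable (\<lambda>n. b n * z ^ n)"
      by (rule powser_inside) (use that st in simp)
    then show ?thesis
      unfolding f_def by (rule summable_sums)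
  qed
  have shift: "(\<lambda>n. a' n * w ^ n) sums x \<longleftrightarrow> (\<lambda>n. w ^ Suc n * a n) sums x" for w x
  proof -
    have "(\<lambda>n. a' n * w ^ n) sums x \<longleftrightarrow> (\<lambda>n. a' (Suc n) * w ^ Suc n) sums x"
      using sums_Suc_iff[of "\<lambda>n. a' n * w ^ n" x] by (simp add: a'_def)
    also have "(\<lambda>n. a' (Suc n) * w ^ Suc n) = (\<lambda>n. w ^ Suc n * a n)"
      by (rule ext) (simp add: a'_def)
    finally show ?thesis .
  qed
  have g: "(\<lambda>n. a' n * w ^ n) sums g w" if "cmod w < 1 / s" for w
  proof -
    have "summable (\<lambda>n. a' n * (1 / of_real s) ^ n)"
    proof -
      have "(\<lambda>n. 1 / of_real s ^ Suc n * a n) sums (\<Sum>n. 1 / of_real s ^ Suc n * a n)"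
        by (rule summable_sums, rule sa) (use st in simp_all)
      then show ?thesis
        unfolding summable_def shift by (intro exI) (simp only: power_divide power_one)
    qed
    then have "summable (\<lambda>n. a' n * w ^ n)"
      by (rule powser_inside) (use that st in \<open>simp add: norm_divide\<close>)
    then show ?thesis
      unfolding g_def by (rule summable_sums)
  qed
  have g0: "g 0 = 0"
    by (simp add: g_def a'_def)
  define F where "F z = (if cmod z < t then f z else - g (1 / z))" for z
  have F2: "F z = - g (1 / z)" if "s < cmod z" for z
  proof (cases "cmod z < t")
    case True
    have "cmod (1 / z) < 1 / s"
      using st that by (simp add: norm_divide frac_less2)
    then have "(\<lambda>n. (1 / z) ^ Suc n * a n) sums g (1 / z)"
      using g shift by blast
    then have "(\<Sum>n. 1 / z ^ Suc n * a n) = g (1 / z)"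
      by (simp add: sums_iff power_divide)
    moreover have "(\<Sum>n. z ^ n * b n) = f z"
      by (simp add: f_def mult.commute)
    ultimately show ?thesis
      using zero[of z] True that by (simp add: F_def add_eq_0_iff)
  qed (simp add: F_def)
  have holf: "f holomorphic_on ball 0 t"
    by (rule power_series_holomorphic[of _ _ b]) (use f in auto)
  have holg: "g holomorphic_on ball 0 (1 / s)"
    by (rule power_series_holomorphic[of _ _ a']) (use g in auto)
  have "F holomorphic_on ball 0 t"
    using holf by (rule holomorphic_transform) (simp add: F_def)
  moreover have "F holomorphic_on - cball 0 s"
  proof (rule holomorphic_transform)
    have "(\<lambda>z. - (g \<circ> (\<lambda>z. 1 / z)) z) holomorphic_on - cball 0 s"
      by (intro holomorphic_on_minus holomorphic_on_compose_gen[OF _ holg] holomorphic_intros)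
        (use st in \<open>auto simp: norm_divide frac_less2\<close>)
    then show "(\<lambda>z. - g (1 / z)) holomorphic_on - cball 0 s" by (simp add: comp_def)
  qed (simp add: F2)
  ultimately have "F holomorphic_on (ball 0 t \<union> - cball 0 s)"
    by (intro holomorphic_on_Un) auto
  moreover have "ball 0 t \<union> - cball 0 s = (UNIV :: complex set)"
    using st by auto
  ultimately have holF: "F holomorphic_on UNIV" by simp
  have "isCont g 0"
    using holomorphic_on_imp_continuous_on[OF holg] st by (simp add: continuous_on_eq_continuous_at)
  then have "((\<lambda>z. - g (inverse z)) \<longlongrightarrow> - g 0) at_infinity"
    by (intro tendsto_minus isCont_tendsto_compose[of 0 g] tendsto_inverse_0)
  moreover have "\<forall>\<^sub>F z in at_infinity. - g (inverse z) = F z"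
    unfolding eventually_at_infinity
    by (rule exI[of _ t]) (auto simp: F_def inverse_eq_divide)
  ultimately have "(F \<longlongrightarrow> 0) at_infinity"
    using Lim_transform_eventually g0 by fastforce
  then have F0: "F z = 0" for z
    using Liouville_weak_0[OF holF] by blast
  have "(\<lambda>n. b n * z ^ n) sums 0" if "cmod z < t" for z
    using f[OF that] F0[of z] that by (simp add: F_def)
  then show "b n = 0"
    using power_series_zero_coeffs[of t b] st by auto
  have "(\<lambda>n. a' n * w ^ n) sums 0" if w: "cmod w < 1 / s" for w
  proof (cases "w = 0")
    case False
    then have "s < cmod (1 / w)"
      using w st by (simp add: norm_divide field_simps)
    then have "g w = 0" using F2[of "1 / w"] F0 by simp
    then show ?thesis using g[OF w] by simp
  qed (use g[OF w] g0 in simp)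
  then have "a' (Suc n) = 0"
    using power_series_zero_coeffs[of "1 / s" a'] st by auto
  then show "a n = 0" by (simp add: a'_def)
qed

section \<open>The Laurent model of a pair of operators\<close>

lemma annulus_closed_subannulus:
  assumes z: "z \<in> annulus a b" and a: "0 \<le> a"
  obtains \<sigma> \<rho> where "0 < \<sigma>" "\<sigma> < cmod z" "cmod z < \<rho>"
    "\<And>u. \<sigma> \<le> cmod u \<Longrightarrow> cmod u \<le> \<rho> \<Longrightarrow> u \<in> annulus a b"
proof -
  have z: "a < cmod z" "ereal (cmod z) < b"
    using z by (auto simp: annulus_def)
  obtain \<rho> where \<rho>: "ereal (cmod z) < ereal \<rho>" "ereal \<rho> < b"
    using ereal_dense2[OF z(2)] by blast
  have "u \<in> annulus a b" if "(a + cmod z) / 2 \<le> cmod u" "cmod u \<le> \<rho>" for u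
    using that z \<rho>(2) unfolding annulus_def
    by (auto intro: le_less_trans[of _ "ereal \<rho>"])
  then show thesis
    using that[of "(a + cmod z) / 2" \<rho>] z a \<rho>(1) by auto
qed

lemma annulus_nonempty:
  assumes "0 \<le> a" "ereal a < b"
  obtains z where "z \<in> annulus a b"
proof -
  obtain r where "ereal a < ereal r" "ereal r < b"
    using ereal_dense2[OF assms(2)] by blast
  then have "complex_of_real r \<in> annulus a b"
    using assms(1) by (auto simp: annulus_def)
  then show thesis by (rule that)
qed

text \<open>\<open>Ra\<close> and \<open>Sa\<close> are the adjoints of \<open>R\<close> and \<open>S\<close>. The two instances are
  \<open>(R, S) = (T, T'\<^sup>*)\<close> and \<open>(R, S) = (T', T\<^sup>*)\<close>.\<close>

locale laurent_setting =
  fixes E :: "'h::chilbert_space set" and a :: real and b :: ereal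
    and R S Ra Sa :: "'h \<Rightarrow> 'h"
  assumes E: "csubspace E" "closed E"
    and R_adj: "adjoint_pair R Ra" and S_adj: "adjoint_pair S Sa"
    and a_nonneg: "0 \<le> a" and a_less_b: "ereal a < b"
    and convergent: "\<And>x. laurent_convergent E (annulus a b) R S x"
    and total: "closure (cspan ({(Ra ^^ n) x |x n. x \<in> E} \<union> {(Sa ^^ n) x |x n. x \<in> E})) = UNIV"
begin

abbreviation P :: "'h \<Rightarrow> 'h" where "P \<equiv> orth_proj cinner E"
abbreviation model :: "'h \<Rightarrow> complex \<Rightarrow> 'h" where "model \<equiv> laurent_model E (annulus a b) R S"

lemma
  assumes "z \<in> annulus a b"
  shows summable_principal: "summable (\<lambda>n. (1 / z ^ Suc n) *\<^sub>C P ((R ^^ Suc n) x))"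
    and summable_regular: "summable (\<lambda>n. z ^ n *\<^sub>C P ((S ^^ n) x))"
  using convergent[of x] assms unfolding laurent_convergent_def by blast+

lemma annulus_nonzero: "z \<in> annulus a b \<Longrightarrow> z \<noteq> 0"
  using a_nonneg by (auto simp: annulus_def)

lemma R_pow_clinear: "clinear (R ^^ n)" and S_pow_clinear: "clinear (S ^^ n)"
  using adjoint_pair_clinear adjoint_pair_funpow R_adj S_adj by blast+

lemma cinner_P_R_pow: "e \<in> E \<Longrightarrow> cinner (P ((R ^^ n) x)) e = cinner x ((Ra ^^ n) e)"
  using adjoint_pairD[OF adjoint_pair_funpow[OF R_adj]] by (simp add: cinner_orth_proj[OF E])

lemma cinner_P_S_pow: "e \<in> E \<Longrightarrow> cinner (P ((S ^^ n) x)) e = cinner x ((Sa ^^ n) e)"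
  using adjoint_pairD[OF adjoint_pair_funpow[OF S_adj]] by (simp add: cinner_orth_proj[OF E])

lemma cinner_E_P_R_pow: "e \<in> E \<Longrightarrow> cinner e (P ((R ^^ n) x)) = cinner ((Ra ^^ n) e) x"
  by (metis cinner_P_R_pow cinner_commute)

lemma cinner_E_P_S_pow: "e \<in> E \<Longrightarrow> cinner e (P ((S ^^ n) x)) = cinner ((Sa ^^ n) e) x"
  by (metis cinner_P_S_pow cinner_commute)

lemma model_clinear: "clinear model"
  unfolding clinear_def
proof (intro conjI allI ext)
  fix x y z
  show "model (x + y) z = (model x + model y) z"
  proof (cases "z \<in> annulus a b")
    case True
    have "P ((R ^^ n) (x + y)) = P ((R ^^ n) x) + P ((R ^^ n) y)"
      "P ((S ^^ n) (x + y)) = P ((S ^^ n) x) + P ((S ^^ n) y)" for n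
      using R_pow_clinear S_pow_clinear by (simp_all add: clinear_def orth_proj_add[OF E])
    then show ?thesis
      using True summable_principal[OF True] summable_regular[OF True]
      by (simp add: laurent_model_def scaleC_add_right suminf_add[symmetric] del: funpow.simps power_Suc)
  qed (simp add: laurent_model_def)
next
  fix c x z
  show "model (c *\<^sub>C x) z = (c *\<^sub>C model x) z"
  proof (cases "z \<in> annulus a b")
    case True
    have "k *\<^sub>C P ((R ^^ n) (c *\<^sub>C x)) = c *\<^sub>C k *\<^sub>C P ((R ^^ n) x)"
      "k *\<^sub>C P ((S ^^ n) (c *\<^sub>C x)) = c *\<^sub>C k *\<^sub>C P ((S ^^ n) x)" for n k
      using R_pow_clinear S_pow_clinear
      by (simp_all add: clinear_def orth_proj_scaleC[OF E] scaleC_scaleC mult.commute)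
    then show ?thesis
      using True summable_principal[OF True] summable_regular[OF True]
      by (simp add: laurent_model_def scaleC_fun_def scaleC_add_right suminf_scaleC
          del: funpow.simps power_Suc)
  qed (simp add: laurent_model_def scaleC_fun_def)
qed

text \<open>The coefficients of the Laurent expansion, tested against \<open>e \<in> E\<close>, are the inner products of
  \<open>x\<close> with the vectors \<open>Ra\<^sup>n e\<close> and \<open>Sa\<^sup>n e\<close>, which are total.\<close>

lemma model_eq_zero:
  assumes "model x = 0"
  shows "x = 0"
proof -
  obtain z0 where "z0 \<in> annulus a b"
    using annulus_nonempty[OF a_nonneg a_less_b] .
  then obtain \<sigma> \<rho> where st: "0 < \<sigma>" "\<sigma> < \<rho>"
    and sub: "\<And>u. \<sigma> \<le> cmod u \<Longrightarrow> cmod u \<le> \<rho> \<Longrightarrow> u \<in> annulus a b"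
    using annulus_closed_subannulus[OF _ a_nonneg] by (metis less_trans)
  have coeffs: "cinner x ((Ra ^^ Suc n) e) = 0 \<and> cinner x ((Sa ^^ n) e) = 0" if e: "e \<in> E" for e n
  proof -
    define \<alpha> where "\<alpha> n = cinner (P ((R ^^ Suc n) x)) e" for n
    define \<beta> where "\<beta> n = cinner (P ((S ^^ n) x)) e" for n
    have sums: "summable (\<lambda>n. 1 / z ^ Suc n * \<alpha> n) \<and> summable (\<lambda>n. z ^ n * \<beta> n)
        \<and> (\<Sum>n. 1 / z ^ Suc n * \<alpha> n) + (\<Sum>n. z ^ n * \<beta> n) = 0"
      if z: "\<sigma> \<le> cmod z" "cmod z \<le> \<rho>" for z
    proof -
      have zA: "z \<in> annulus a b" using sub z by blast
      have "cinner (model x z) e = 0"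
        using assms by simp
      then show ?thesis
        using summable_cinner_left[OF summable_principal[OF zA], of x e]
          summable_cinner_left[OF summable_regular[OF zA], of x e]
          suminf_cinner_left[OF summable_principal[OF zA], of x e]
          suminf_cinner_left[OF summable_regular[OF zA], of x e] zA
        by (simp add: laurent_model_def cinner_add_left cinner_scaleC_left \<alpha>_def \<beta>_def
          del: funpow.simps power_Suc)
    qed
    have "\<alpha> n = 0"
      by (rule laurent_series_zero_coeffs(1)[OF st, of \<alpha> \<beta>]) (use sums in blast)+
    moreover have "\<beta> n = 0"
      by (rule laurent_series_zero_coeffs(2)[OF st, of \<alpha> \<beta>]) (use sums in blast)+
    ultimately show ?thesis
      unfolding \<alpha>_def \<beta>_def by (simp add: cinner_P_R_pow[OF e] cinner_P_S_pow[OF e] del: funpow.simps)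
  qed
  show ?thesis
  proof (rule orthogonal_total_eq_zero[OF total])
    fix y
    assume "y \<in> {(Ra ^^ n) x |x n. x \<in> E} \<union> {(Sa ^^ n) x |x n. x \<in> E}"
    then consider e n where "e \<in> E" "y = (Ra ^^ n) e" | e n where "e \<in> E" "y = (Sa ^^ n) e"
      by blast
    then show "cinner x y = 0"
    proof cases
      case 1
      \<comment> \<open>The principal part only yields positive powers; the vector \<open>e\<close> itself comes from the
        regular part.\<close>
      then show ?thesis
        using coeffs[OF 1(1), of 0] coeffs[OF 1(1), of "n - 1"] by (cases n) auto
    qed (use coeffs in auto)
  qed
qed

lemma inj_model: "inj model"
proof (rule injI)
  fix x y
  assume "model x = model y"
  then have "model (x - y) = 0"
    by (simp add: clinear_diff[OF model_clinear])
  then show "x = y"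
    using model_eq_zero[of "x - y"] by simp
qed

lemma model_in_E: "model x z \<in> E"
proof (cases "z \<in> annulus a b")
  case True
  then show ?thesis
    unfolding laurent_model_def
    by (auto intro!: csubspace_simps[OF E(1)] csubspace_suminf[OF E] orth_proj_in[OF E]
        summable_principal summable_regular simp del: funpow.simps power_Suc)
qed (simp add: laurent_model_def csubspace_simps[OF E(1)])

text \<open>Multiplication by \<open>z\<close> shifts the Laurent series: the coefficient of \<open>1 / z\<close> moves into the
  regular part as its constant term \<open>P (R x)\<close>, and \<open>S\<^sup>n\<^sup>+\<^sup>1 (R x) = S\<^sup>n x\<close> gives the remaining
  ones.\<close>

lemma mult_z_model:
  assumes SR: "\<And>x. S (R x) = x"
  shows "mult_z (model x) = model (R x)"
proof
  fix z
  show "mult_z (model x) z = model (R x) z"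
  proof (cases "z \<in> annulus a b")
    case True
    note z = annulus_nonzero[OF True]
    let ?p = "\<lambda>n. (1 / z ^ Suc n) *\<^sub>C P ((R ^^ Suc n) x)" and ?q = "\<lambda>n. z ^ n *\<^sub>C P ((S ^^ n) x)"
    let ?q' = "\<lambda>n. z ^ n *\<^sub>C P ((S ^^ n) (R x))"
    have p': "(1 / z ^ Suc n) *\<^sub>C P ((R ^^ Suc n) (R x)) = z *\<^sub>C ?p (Suc n)" for n
      using z by (simp add: scaleC_scaleC funpow_swap1)
    have "(\<Sum>n. z *\<^sub>C ?p (Suc n)) = z *\<^sub>C (\<Sum>n. ?p (Suc n))"
      by (rule suminf_scaleC[symmetric])
        (use summable_principal[OF True, of x] in \<open>subst summable_Suc_iff\<close>)
    also have "\<dots> = z *\<^sub>C (suminf ?p - ?p 0)"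
      by (subst suminf_split_head[OF summable_principal[OF True]]) simp
    also have "\<dots> = z *\<^sub>C suminf ?p - P (R x)"
      using z by (simp add: complex_vector.scale_right_diff_distrib scaleC_scaleC scaleC_one)
    finally have 1: "(\<Sum>n. (1 / z ^ Suc n) *\<^sub>C P ((R ^^ Suc n) (R x))) = z *\<^sub>C suminf ?p - P (R x)"
      by (simp only: p')
    have "?q' (Suc n) = z *\<^sub>C ?q n" for n
      by (simp add: scaleC_scaleC funpow_swap1 SR)
    then have "(\<Sum>n. ?q' (Suc n)) = z *\<^sub>C suminf ?q"
      by (simp only: suminf_scaleC[OF summable_regular[OF True]])
    then have 2: "suminf ?q' = P (R x) + z *\<^sub>C suminf ?q"
      using suminf_split_head[OF summable_regular[OF True, of "R x"]] by (simp add: scaleC_one)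
    show ?thesis
      using True unfolding mult_z_def laurent_model_def by (simp only: if_True 1 2 scaleC_add_right) simp
  qed (simp add: mult_z_def laurent_model_def)
qed

text \<open>The convergence assumption concerns \<open>P R\<^sup>n x\<close> and \<open>P S\<^sup>n x\<close> and thus controls \<open>Ra\<^sup>n e\<close> and
  \<open>Sa\<^sup>n e\<close> only weakly. Since it holds on an open annulus, it can be used on a circle of radius
  \<open>\<sigma> < \<bar>w\<bar>\<close> for the principal part and \<open>\<rho> > \<bar>w\<bar>\<close> for the regular part, which leaves room
  for a geometric series.\<close>

lemma
  assumes w: "w \<in> annulus a b" and e: "e \<in> E"
  shows summable_adjoint_principal: "summable (\<lambda>n. (1 / cnj w ^ Suc n) *\<^sub>C (Ra ^^ Suc n) e)"
    and summable_adjoint_regular: "summable (\<lambda>n. cnj w ^ n *\<^sub>C (Sa ^^ n) e)"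
proof -
  obtain \<sigma> \<rho> where sr: "0 < \<sigma>" "\<sigma> < cmod w" "cmod w < \<rho>"
    and sub: "\<And>u. \<sigma> \<le> cmod u \<Longrightarrow> cmod u \<le> \<rho> \<Longrightarrow> u \<in> annulus a b"
    using annulus_closed_subannulus[OF w a_nonneg] by blast
  have A: "complex_of_real \<sigma> \<in> annulus a b" "complex_of_real \<rho> \<in> annulus a b"
    using sub sr by auto
  have bounded_terms: "\<exists>C. \<forall>n. norm (f n) \<le> C" if "summable f" for f :: "nat \<Rightarrow> complex"
    using summable_imp_Bseq[OF that] by (auto simp: Bseq_def)
  have "\<exists>C. \<forall>n. cmod (cinner x ((Sa ^^ n) e)) * \<rho> ^ n \<le> C" for x
    using bounded_terms[OF summable_cinner_left[OF summable_regular[OF A(2)]], of x e] sr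
    by (simp add: cinner_scaleC_left cinner_P_S_pow[OF e] norm_mult norm_power mult.commute)
  then show "summable (\<lambda>n. cnj w ^ n *\<^sub>C (Sa ^^ n) e)"
    by (rule summable_power_scaleC_of_weakly_bounded) (use sr in simp)
  \<comment> \<open>The principal part is \<open>1 / cnj w\<close> times a power series in \<open>1 / cnj w\<close>; the circle of radius
    \<open>\<sigma>\<close> for \<open>w\<close> becomes the one of radius \<open>1 / \<sigma>\<close> for \<open>1 / cnj w\<close>.\<close>
  have "\<exists>C. \<forall>n. cmod (cinner x ((1 / cnj w) *\<^sub>C (Ra ^^ Suc n) e)) * (1 / \<sigma>) ^ n \<le> C" for x
  proof -
    obtain C where C: "\<And>n. norm (cinner ((1 / of_real \<sigma> ^ Suc n) *\<^sub>C P ((R ^^ Suc n) x)) e) \<le> C"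
      using bounded_terms[OF summable_cinner_left[OF summable_principal[OF A(1)]], of x e] by blast
    have "cmod (cinner x ((1 / cnj w) *\<^sub>C (Ra ^^ Suc n) e)) * (1 / \<sigma>) ^ n \<le> \<sigma> / cmod w * C" for n
    proof -
      have "cmod (cinner x ((1 / cnj w) *\<^sub>C (Ra ^^ Suc n) e)) * (1 / \<sigma>) ^ n
        = \<sigma> / cmod w * norm (cinner ((1 / of_real \<sigma> ^ Suc n) *\<^sub>C P ((R ^^ Suc n) x)) e)"
        using sr by (simp add: cinner_scaleC_left cinner_scaleC_right cinner_P_R_pow[OF e]
            norm_mult norm_divide norm_power power_divide del: funpow.simps)
      also have "\<dots> \<le> \<sigma> / cmod w * C"
        using sr by (intro mult_left_mono C) auto
      finally show ?thesis .
    qed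
    then show ?thesis by blast
  qed
  then have "summable (\<lambda>n. (1 / cnj w) ^ n *\<^sub>C (1 / cnj w) *\<^sub>C (Ra ^^ Suc n) e)"
    by (rule summable_power_scaleC_of_weakly_bounded) (use sr in \<open>simp add: norm_divide frac_less2\<close>)
  then show "summable (\<lambda>n. (1 / cnj w ^ Suc n) *\<^sub>C (Ra ^^ Suc n) e)"
    by (simp add: scaleC_scaleC power_divide mult.commute del: funpow.simps)
qed

text \<open>The link between the two models: for \<open>(R, S) = (T', T\<^sup>*)\<close> the adjoints \<open>Ra\<close> and \<open>Sa\<close> are \<open>T'\<^sup>*\<close>
  and \<open>T\<close>, and the vector on the right is the one whose image under \<open>U\<close> is \<open>\<Psi> (cnj w) e\<close>.\<close>

lemma cinner_model:
  assumes w: "w \<in> annulus a b" and e: "e \<in> E"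
  shows "cinner e (model x w)
    = cinner ((\<Sum>n. (1 / cnj w ^ Suc n) *\<^sub>C (Ra ^^ Suc n) e) + (\<Sum>n. cnj w ^ n *\<^sub>C (Sa ^^ n) e)) x"
proof -
  have "cinner e ((1 / w ^ Suc n) *\<^sub>C P ((R ^^ Suc n) x))
      = cinner ((1 / cnj w ^ Suc n) *\<^sub>C (Ra ^^ Suc n) e) x"
    "cinner e (w ^ n *\<^sub>C P ((S ^^ n) x)) = cinner (cnj w ^ n *\<^sub>C (Sa ^^ n) e) x" for n
    by (simp_all add: cinner_scaleC_left cinner_scaleC_right cinner_E_P_R_pow[OF e]
        cinner_E_P_S_pow[OF e] del: funpow.simps)
  then show ?thesis
    using w by (simp add: laurent_model_def cinner_add_left cinner_add_right
        suminf_cinner_right[OF summable_principal[OF w]] suminf_cinner_right[OF summable_regular[OF w]]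
        suminf_cinner_left[OF summable_adjoint_principal[OF w e]]
        suminf_cinner_left[OF summable_adjoint_regular[OF w e]] del: funpow.simps power_Suc)
qed

end

section \<open>Transport of structure along a unitary map\<close>

text \<open>An injective linear map \<open>U\<close> is unitary onto its range with the induced inner product. The
  adjoints, projections, series and functionals of the range, each of which is defined by a unique
  description, are the images of those of the Hilbert space.\<close>

locale unitary_model =
  fixes U :: "'h::chilbert_space \<Rightarrow> 'f::complex_vector"
  assumes U_clinear: "clinear U" and inj_U: "inj U"
begin

abbreviation ip where "ip \<equiv> induced_inner U"
abbreviation nrm where "nrm \<equiv> induced_norm U"

lemma ip_U [simp]: "ip (U x) (U y) = cinner x y"
  by (simp add: induced_inner_def inv_f_f[OF inj_U])

lemma nrm_U [simp]: "nrm (U x) = norm x"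
  by (simp add: induced_norm_def inv_f_f[OF inj_U])

lemma U_add: "U (x + y) = U x + U y" and U_scaleC: "U (c *\<^sub>C x) = c *\<^sub>C U x"
  and U_diff: "U (x - y) = U x - U y" and U_zero: "U 0 = 0"
  using U_clinear clinear_diff clinear_zero unfolding clinear_def by blast+

lemma U_eq_zero: "U x = 0 \<longleftrightarrow> x = 0"
  using injD[OF inj_U, of x 0] U_zero by auto

lemma U_sum: "U (\<Sum>n<N. v n) = (\<Sum>n<N. U (v n))" for N :: nat
  by (induction N) (simp_all add: U_zero U_add)

lemma adjoint_of_U: "adjoint_on UNIV cinner ip U (U y) = y"
  unfolding adjoint_on_def
  by (rule the_equality) (auto intro: cinner_ext_right)

lemma adjoint_on_model:
  assumes M: "\<And>x. M (U x) = U (A x)" and A: "adjoint_pair A B"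
  shows "adjoint_on (range U) ip ip M (U y) = U (B y)"
  unfolding adjoint_on_def
proof (rule the_equality)
  show "U (B y) \<in> range U \<and> (\<forall>x\<in>range U. ip (M x) (U y) = ip x (U (B y)))"
    by (auto simp: M adjoint_pairD[OF A])
next
  fix v
  assume v: "v \<in> range U \<and> (\<forall>x\<in>range U. ip (M x) (U y) = ip x v)"
  then obtain u where u: "v = U u" by blast
  have "B y = u"
    by (rule cinner_ext_right) (use v in \<open>auto simp: u M adjoint_pairD[OF A]\<close>)
  then show "v = U (B y)" by (simp add: u)
qed

lemma orth_proj_model:
  assumes K: "csubspace K" and y: "y \<in> K" "\<And>m. m \<in> K \<Longrightarrow> cinner (x - y) m = 0"
  shows "orth_proj ip (U ` K) (U x) = U y"
  unfolding orth_proj_def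
proof (rule the_equality)
  show "U y \<in> U ` K \<and> (\<forall>m\<in>U ` K. ip (U x - U y) m = 0)"
    using y by (auto simp flip: U_diff)
next
  fix v
  assume v: "v \<in> U ` K \<and> (\<forall>m\<in>U ` K. ip (U x - v) m = 0)"
  then obtain u where u: "u \<in> K" "v = U u" by blast
  have "orth_proj cinner K x = u"
    by (rule orth_proj_eqI[OF K u(1)]) (use v in \<open>auto simp: u(2) simp flip: U_diff\<close>)
  then show "v = U y"
    using orth_proj_eqI[OF K y] u(2) by simp
qed

lemma suminf_on_model:
  assumes "summable v"
  shows "suminf_on (range U) nrm (\<lambda>n. U (v n)) = U (suminf v)"
  unfolding suminf_on_def
proof (rule the_equality)
  have *: "nrm ((\<Sum>n<N. U (v n)) - U s) = norm ((\<Sum>n<N. v n) - s)" for N s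
    by (simp flip: U_sum U_diff)
  have lim: "(\<lambda>N. \<Sum>n<N. v n) \<longlonglongrightarrow> suminf v"
    using assms by (rule summable_LIMSEQ)
  then show "U (suminf v) \<in> range U \<and> (\<lambda>N. nrm ((\<Sum>n<N. U (v n)) - U (suminf v))) \<longlonglongrightarrow> 0"
    unfolding * by (simp add: tendsto_norm_zero_iff LIM_zero_iff)
  fix t
  assume t: "t \<in> range U \<and> (\<lambda>N. nrm ((\<Sum>n<N. U (v n)) - t)) \<longlonglongrightarrow> 0"
  then obtain s where s: "t = U s" by blast
  have "(\<lambda>N. \<Sum>n<N. v n) \<longlonglongrightarrow> s"
    using t unfolding s * by (simp add: tendsto_norm_zero_iff LIM_zero_iff)
  then have "s = suminf v"
    using lim LIMSEQ_unique by blast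
  then show "t = U (suminf v)" by (simp add: s)
qed

text \<open>The functional \<open>\<langle>\<cdot>, U y\<rangle>\<close>; the value \<open>0\<close> off the range is the normalisation that
  \<^const>\<open>dual_space\<close> requires.\<close>

definition functional :: "'h \<Rightarrow> 'f \<Rightarrow> complex"
  where "functional y f = (if f \<in> range U then ip f (U y) else 0)"

lemma functional_U [simp]: "functional y (U x) = cinner x y"
  by (simp add: functional_def)

lemma functional_in_dual_space: "functional y \<in> dual_space (range U) nrm"
proof -
  have "\<exists>K. \<forall>f\<in>range U. cmod (functional y f) \<le> K * nrm f"
    by (rule exI[of _ "norm y"]) (auto simp: cmod_cinner_le mult.commute[of "norm y"])
  moreover have "\<forall>f. f \<notin> range U \<longrightarrow> functional y f = 0"
    by (simp add: functional_def)
  ultimately show ?thesis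
    unfolding dual_space_def
    by (auto simp: cinner_add_left cinner_scaleC_left simp flip: U_add U_scaleC)
qed

lemma dual_space_functional:
  assumes \<phi>: "\<phi> \<in> dual_space (range U) nrm"
  obtains y where "\<phi> = functional y"
proof -
  have add: "\<phi> (U x + U y) = \<phi> (U x) + \<phi> (U y)" and scale: "\<phi> (c *\<^sub>C U x) = c * \<phi> (U x)"
    and off: "f \<notin> range U \<Longrightarrow> \<phi> f = 0" for x y c f
    using \<phi> unfolding dual_space_def by blast+
  obtain K where K: "\<And>x. cmod (\<phi> (U x)) \<le> K * norm x"
    using \<phi> unfolding dual_space_def by auto
  obtain y where "\<And>x. \<phi> (U x) = cinner x y"
    by (rule riesz_representation[of "\<lambda>x. \<phi> (U x)" K]) (simp_all add: U_add U_scaleC add scale K)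
  then have "\<phi> = functional y"
    using off by (auto simp: functional_def fun_eq_iff)
  then show thesis by (rule that)
qed

lemma dual_norm_functional: "dual_norm (range U) nrm (functional y) = norm y"
proof -
  have "dual_norm (range U) nrm (functional y) = (SUP x\<in>{x. norm x \<le> 1}. cmod (cinner x y))"
  proof -
    have "{f \<in> range U. nrm f \<le> 1} = U ` {x. norm x \<le> 1}" by auto
    then show ?thesis
      unfolding dual_norm_def by (simp add: image_image)
  qed
  also have "\<dots> = norm y"
  proof (rule antisym)
    have le: "cmod (cinner x y) \<le> norm y" if "norm x \<le> 1" for x
      using cmod_cinner_le[of x y] mult_right_mono[OF that norm_ge_zero[of y]] by simp
    show "(SUP x\<in>{x. norm x \<le> 1}. cmod (cinner x y)) \<le> norm y"
      by (rule cSUP_least) (use le in \<open>auto intro: exI[of _ 0]\<close>)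
    have bdd: "bdd_above ((\<lambda>x. cmod (cinner x y)) ` {x. norm x \<le> 1})"
      by (rule bdd_aboveI[of _ "norm y"]) (use le in auto)
    \<comment> \<open>The unit vector in the direction of \<open>y\<close>, and \<open>0\<close> if \<open>y = 0\<close>.\<close>
    define u where "u = complex_of_real (inverse (norm y)) *\<^sub>C y"
    have "norm y = cmod (cinner u y)"
      by (cases "y = 0")
        (simp_all add: u_def cinner_scaleC_left cinner_self norm_mult norm_inverse power2_eq_square)
    also have "\<dots> \<le> (SUP x\<in>{x. norm x \<le> 1}. cmod (cinner x y))"
      by (rule cSUP_upper[OF _ bdd]) (cases "y = 0"; simp add: u_def norm_scaleC norm_inverse)
    finally show "norm y \<le> (SUP x\<in>{x. norm x \<le> 1}. cmod (cinner x y))" .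
  qed
  finally show ?thesis .
qed

lemma psi_map_model:
  assumes L: "\<And>x. L (U x) = U (S x)" and M: "\<And>x. M (U x) = U (R x)"
    and sum: "summable (\<lambda>n. (1 / w ^ Suc n) *\<^sub>C (S ^^ Suc n) e)" "summable (\<lambda>n. w ^ n *\<^sub>C (R ^^ n) e)"
  shows "psi_map (range U) nrm L M U w e
    = U ((\<Sum>n. (1 / w ^ Suc n) *\<^sub>C (S ^^ Suc n) e) + (\<Sum>n. w ^ n *\<^sub>C (R ^^ n) e))"
proof -
  have "(L ^^ n) (U e) = U ((S ^^ n) e)" "(M ^^ n) (U e) = U ((R ^^ n) e)" for n
    by (induction n) (simp_all add: L M)
  then show ?thesis
    unfolding psi_map_def by (simp only: U_scaleC[symmetric] suminf_on_model[OF sum(1)]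
        suminf_on_model[OF sum(2)] U_add)
qed

end

text \<open>The assumption \<open>Ra R S = Ra\<close> makes \<open>x - R (S x)\<close> the orthogonal projection of \<open>x\<close> onto the
  kernel of \<open>Ra\<close>; subtracting its model from that of \<open>x\<close> leaves \<open>z\<close> times the model of \<open>S x\<close>.\<close>

lemma mult_z_left_inverse_model:
  fixes U :: "'h::chilbert_space \<Rightarrow> complex \<Rightarrow> 'h"
  assumes U: "unitary_model U" and M: "\<And>x. mult_z (U x) = U (R x)" and U0: "\<And>x. U x 0 = 0"
    and R: "adjoint_pair R Ra" and proj: "\<And>x. Ra (R (S x)) = Ra x"
  shows "mult_z_left_inverse (range U) (induced_inner U) (U x) = U (S x)"
proof -
  interpret unitary_model U by fact
  let ?K = "{x. Ra x = 0}"
  have Ra: "clinear Ra"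
    using R adjoint_pair_clinear adjoint_pair_sym by blast
  have K: "csubspace ?K"
    unfolding complex_vector.subspace_def using Ra clinear_zero[OF Ra] by (simp add: clinear_def)
  have ker: "{g \<in> range U. adjoint_on (range U) ip ip mult_z g = 0} = U ` ?K"
    by (auto simp: adjoint_on_model[OF M R] U_eq_zero)
  have "orth_proj ip (U ` ?K) (U x) = U (x - R (S x))"
  proof (rule orth_proj_model[OF K])
    show "x - R (S x) \<in> ?K"
      by (simp add: clinear_diff[OF Ra] proj)
    show "cinner (x - (x - R (S x))) m = 0" if "m \<in> ?K" for m
      using that by (simp add: adjoint_pairD[OF R])
  qed
  then have "U x - orth_proj ip (U ` ?K) (U x) = mult_z (U (S x))"
    by (simp add: M U_diff)
  then have *: "U x z - orth_proj ip (U ` ?K) (U x) z = z *\<^sub>C U (S x) z" for z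
    by (simp add: fun_eq_iff mult_z_def)
  have "mult_z_left_inverse (range U) ip (U x) z = U (S x) z" for z
    unfolding mult_z_left_inverse_def ker *
    by (cases "z = 0") (simp_all add: U0 scaleC_scaleC scaleC_one)
  then show ?thesis by blast
qed

section \<open>The Cauchy dual of a left-invertible operator\<close>

text \<open>Let \<open>S\<close> be a bounded left inverse. Then \<open>T S\<close> is a bounded idempotent onto the range of \<open>T\<close>,
  which is therefore closed. As \<open>T\<^sup>* S\<^sup>* y = y\<close>, projecting \<open>S\<^sup>* y\<close> to a vector \<open>T x\<close> in the range
  changes it by something that \<open>T\<^sup>*\<close> annihilates, and so \<open>T\<^sup>* T x = y\<close>.\<close>

lemma left_invertible_gram_bij:
  assumes T: "bounded_clinear T" "left_invertible T" and adj: "adjoint_pair T Ta"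
  shows "bij (Ta \<circ> T)"
proof -
  obtain S where S: "bounded_clinear S" "\<And>x. S (T x) = x"
    using T(2) unfolding left_invertible_def by (metis comp_apply id_apply)
  have bS: "bounded_linear S" and bT: "bounded_linear T"
    using S(1) T(1) unfolding bounded_clinear_def by blast+
  have Tc: "clinear T" using adjoint_pair_clinear[OF adj] .
  have Tac: "clinear Ta" using adjoint_pair_clinear[OF adjoint_pair_sym[OF adj]] .
  note Sa = adjoint_pair_cadjoint[OF S(1)]
  have Sc: "clinear S" using adjoint_pair_clinear[OF Sa] .
  have range: "range T = {y. T (S y) = y}"
    using S(2) by (auto simp: image_iff) metis
  have "closed (range T)"
    unfolding range
    by (intro closed_Collect_eq continuous_on_id
        linear_continuous_on[OF bounded_linear_compose[OF bT bS]])
  moreover have "csubspace (range T)"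
    unfolding range complex_vector.subspace_def
    using Sc Tc clinear_zero[OF Sc] clinear_zero[OF Tc] by (simp add: clinear_def)
  ultimately have range_T: "csubspace (range T)" "closed (range T)" by auto
  have "inj (Ta \<circ> T)"
  proof (rule injI)
    fix x y
    assume "(Ta \<circ> T) x = (Ta \<circ> T) y"
    then have "Ta (T (x - y)) = 0"
      by (simp add: clinear_diff[OF Tc] clinear_diff[OF Tac])
    then have "cinner (T (x - y)) (T (x - y)) = 0"
      by (simp add: adjoint_pairD[OF adj])
    then have "T x = T y"
      by (simp add: clinear_diff[OF Tc])
    then show "x = y" by (metis S(2))
  qed
  moreover have "\<exists>x. y = (Ta \<circ> T) x" for y
  proof -
    have TaSa: "Ta (cadjoint S y) = y"
      by (rule cinner_ext_right) (simp add: S(2) flip: adjoint_pairD[OF adj] adjoint_pairD[OF Sa])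
    obtain p where p: "p \<in> range T" "\<And>m. m \<in> range T \<Longrightarrow> cinner (cadjoint S y - p) m = 0"
      using orthogonal_projection_exists[OF range_T, of "cadjoint S y"] by blast
    then obtain x where x: "p = T x" by blast
    have "Ta (cadjoint S y - p) = 0"
    proof (rule cinner_ext_right)
      fix u
      have "cinner (T u) (cadjoint S y - p) = 0"
        using p(2)[of "T u"] cinner_eq_zero_sym by blast
      then show "cinner u (Ta (cadjoint S y - p)) = cinner u 0"
        by (simp add: adjoint_pairD[OF adj])
    qed
    then have "y = (Ta \<circ> T) x"
      by (simp add: clinear_diff[OF Tac] TaSa x)
    then show ?thesis by blast
  qed
  ultimately show ?thesis
    unfolding bij_def surj_def by blast
qed

text \<open>With \<open>G\<close> the inverse of \<open>T\<^sup>* T\<close>, which is self-adjoint, the adjoint of \<open>T' = T G\<close> is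
  \<open>G T\<^sup>*\<close>, and the two identities become \<open>G T\<^sup>* T = 1\<close> and \<open>T\<^sup>* T G T\<^sup>* = T\<^sup>*\<close>. The second one says that
  \<open>1 - T T'\<^sup>*\<close> maps into the kernel of \<open>T\<^sup>*\<close>.\<close>

lemma cauchy_dual_adjoint:
  assumes T: "bounded_clinear T" "left_invertible T"
  shows "adjoint_pair (cauchy_dual T) (cadjoint (cauchy_dual T))"
    and "cadjoint (cauchy_dual T) (T x) = x"
    and "cadjoint T (T (cadjoint (cauchy_dual T) x)) = cadjoint T x"
proof -
  let ?Ta = "cadjoint T"
  note adj = adjoint_pair_cadjoint[OF T(1)]
  note bij = left_invertible_gram_bij[OF T adj]
  define G where "G = inv (?Ta \<circ> T)"
  have G1: "?Ta (T (G y)) = y" for y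
    using surj_f_inv_f[OF bij_is_surj[OF bij], of y] by (simp add: G_def)
  have G2: "G (?Ta (T x)) = x" for x
    using inv_f_f[OF bij_is_inj[OF bij], of x] by (simp add: G_def)
  have "adjoint_pair G G"
    unfolding adjoint_pair_def
  proof (intro allI)
    fix x y
    have "cinner (G x) y = cinner (G x) (?Ta (T (G y)))" by (simp only: G1)
    also have "\<dots> = cinner (?Ta (T (G x))) (G y)"
      by (simp only: adjoint_pairD[OF adj, symmetric] adjoint_pairD[OF adjoint_pair_sym[OF adj]])
    finally show "cinner (G x) y = cinner x (G y)" by (simp only: G1)
  qed
  then have "adjoint_pair (T \<circ> G) (G \<circ> ?Ta)"
    by (intro adjoint_pair_comp adj)
  then have *: "adjoint_pair (cauchy_dual T) (G \<circ> ?Ta)"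
    by (simp add: cauchy_dual_def G_def)
  note ** = cadjoint_eqI[OF *]
  show "adjoint_pair (cauchy_dual T) (cadjoint (cauchy_dual T))"
    using * unfolding ** .
  show "cadjoint (cauchy_dual T) (T x) = x" "?Ta (T (cadjoint (cauchy_dual T) x)) = ?Ta x"
    unfolding ** by (simp_all add: G1 G2)
qed

section \<open>The model of the Cauchy dual is the Cauchy dual space\<close>

theorem theorem6p3:
  fixes T T' :: "'h::chilbert_space \<Rightarrow> 'h"
    and E :: "'h set"
    and rm rm' :: real
    and rp rp' :: ereal
    and \<Omega> \<Omega>' :: "complex set"
    and U U' :: "'h \<Rightarrow> complex \<Rightarrow> 'h"
    and H H' B' :: "(complex \<Rightarrow> 'h) set"
    and ip :: "(complex \<Rightarrow> 'h) \<Rightarrow> (complex \<Rightarrow> 'h) \<Rightarrow> complex"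
    and nrm :: "(complex \<Rightarrow> 'h) \<Rightarrow> real"
    and L :: "(complex \<Rightarrow> 'h) \<Rightarrow> complex \<Rightarrow> 'h"
    and \<Psi> :: "complex \<Rightarrow> 'h \<Rightarrow> complex \<Rightarrow> 'h"
    and \<U> :: "((complex \<Rightarrow> 'h) \<Rightarrow> complex) \<Rightarrow> complex \<Rightarrow> 'h"
  assumes "bounded_clinear T" and "left_invertible T"
    and T'_def: "T' = cauchy_dual T"
    and "csubspace E" and "closed E"
    and "closure (cspan ({(cadjoint T ^^ n) x |x n. x \<in> E} \<union> {(T' ^^ n) x |x n. x \<in> E})) = UNIV"
    and "closure (cspan ({(cadjoint T' ^^ n) x |x n. x \<in> E} \<union> {(T ^^ n) x |x n. x \<in> E})) = UNIV"
    and "0 \<le> rm" and "ereal rm < rp" and "0 \<le> rm'" and "ereal rm' < rp'"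
    and \<Omega>_def: "\<Omega> = annulus rm rp"
    and \<Omega>'_def: "\<Omega>' = annulus rm' rp'"
    and "\<And>x. laurent_convergent E \<Omega> T (cadjoint T') x"
    and "\<And>x. laurent_convergent E \<Omega>' T' (cadjoint T) x"
    and U_def: "U = laurent_model E \<Omega> T (cadjoint T')"
    and U'_def: "U' = laurent_model E \<Omega>' T' (cadjoint T)"
    and H_def: "H = range U"
    and H'_def: "H' = range U'"
    and ip_def: "ip = induced_inner U"
    and nrm_def: "nrm = induced_norm U"
    and L_def: "L = mult_z_left_inverse H ip"
    and \<Psi>_def: "\<Psi> = psi_map H nrm L mult_z U"
    and \<U>_def: "\<U> = dual_map E \<Omega>' \<Psi>"
    and B'_def: "B' = cauchy_dual_space E \<Omega>' H nrm \<Psi>"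
  shows "H' = B'
    \<and> (\<forall>h\<in>H'. induced_norm U' h = cauchy_dual_norm E \<Omega>' H nrm \<Psi> h)
    \<and> (\<forall>\<phi>\<in>dual_space H nrm. \<forall>g\<in>H. (\<forall>f\<in>H. \<phi> f = ip f g)
          \<longrightarrow> \<U> \<phi> = U' (adjoint_on UNIV cinner ip U g))"
proof -
  note T = \<open>bounded_clinear T\<close> \<open>left_invertible T\<close>
  note adj = adjoint_pair_cadjoint[OF T(1)]
  note adj' = cauchy_dual_adjoint(1)[OF T, folded T'_def]
  note T'T = cauchy_dual_adjoint(2)[OF T, folded T'_def]
  note proj = cauchy_dual_adjoint(3)[OF T, folded T'_def]
  \<comment> \<open>The model of \<open>T\<close> and the model of its Cauchy dual; the adjoint of \<open>T'\<^sup>*\<close> is \<open>T'\<close>, that of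
    \<open>T\<^sup>*\<close> is \<open>T\<close>.\<close>
  interpret M: laurent_setting E rm rp T "cadjoint T'" "cadjoint T" T'
  proof
    show "closure (cspan ({(cadjoint T ^^ n) x |x n. x \<in> E} \<union> {(T' ^^ n) x |x n. x \<in> E})) = UNIV"
      by fact
    show "laurent_convergent E (annulus rm rp) T (cadjoint T') x" for x
      using \<open>laurent_convergent E \<Omega> T (cadjoint T') x\<close> unfolding \<Omega>_def .
  qed (fact | rule adj adj' adjoint_pair_sym[OF adj'])+
  interpret M': laurent_setting E rm' rp' T' "cadjoint T" "cadjoint T'" T
  proof
    show "closure (cspan ({(cadjoint T' ^^ n) x |x n. x \<in> E} \<union> {(T ^^ n) x |x n. x \<in> E})) = UNIV"
      by fact
    show "laurent_convergent E (annulus rm' rp') T' (cadjoint T) x" for x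
      using \<open>laurent_convergent E \<Omega>' T' (cadjoint T) x\<close> unfolding \<Omega>'_def .
  qed (fact | rule adj adj' adjoint_pair_sym[OF adj])+
  have U: "U = M.model" and U': "U' = M'.model"
    by (simp_all only: U_def U'_def \<Omega>_def \<Omega>'_def)
  interpret UM: unitary_model U
    unfolding U by unfold_locales (rule M.model_clinear M.inj_model)+
  interpret UM': unitary_model U'
    unfolding U' by unfold_locales (rule M'.model_clinear M'.inj_model)+

  have mult: "mult_z (U x) = U (T x)" for x
    unfolding U by (rule M.mult_z_model) (rule T'T)
  have U0: "U x 0 = 0" for x
    using M.annulus_nonzero[of 0] by (auto simp: U laurent_model_def)
  have L: "L (U x) = U (cadjoint T' x)" for x
    unfolding L_def H_def ip_def
    by (rule mult_z_left_inverse_model[where R = T and Ra = "cadjoint T"])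
      (fact UM.unitary_model_axioms mult U0 adj proj)+
  have Psi: "\<Psi> (cnj w) e = U ((\<Sum>n. (1 / cnj w ^ Suc n) *\<^sub>C (cadjoint T' ^^ Suc n) e)
      + (\<Sum>n. cnj w ^ n *\<^sub>C (T ^^ n) e))" if "w \<in> \<Omega>'" "e \<in> E" for w e
    unfolding \<Psi>_def H_def nrm_def
  proof (rule UM.psi_map_model[where R = T and S = "cadjoint T'"])
    show "summable (\<lambda>n. (1 / cnj w ^ Suc n) *\<^sub>C (cadjoint T' ^^ Suc n) e)"
      "summable (\<lambda>n. cnj w ^ n *\<^sub>C (T ^^ n) e)"
      using that unfolding \<Omega>'_def
      by (rule M'.summable_adjoint_principal, rule M'.summable_adjoint_regular)
  qed (fact L mult)+

  \<comment> \<open>\<open>UM.functional y\<close> is the functional \<open>\<langle>\<cdot>, U y\<rangle>\<close> on \<open>\<H>\<close>.\<close>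
  have dual: "\<U> (UM.functional y) = U' y" for y
  proof
    fix w
    show "\<U> (UM.functional y) w = U' y w"
    proof (cases "w \<in> \<Omega>'")
      case True
      have rep: "UM.functional y (\<Psi> (cnj w) e) = cinner e (U' y w)" if "e \<in> E" for e
        unfolding Psi[OF True that] UM.functional_U U'
        using M'.cinner_model[OF _ that] True by (simp only: \<Omega>'_def)
      have "(THE v. v \<in> E \<and> (\<forall>e\<in>E. UM.functional y (\<Psi> (cnj w) e) = cinner e v)) = U' y w"
      proof (rule the_equality)
        show "U' y w \<in> E \<and> (\<forall>e\<in>E. UM.functional y (\<Psi> (cnj w) e) = cinner e (U' y w))"
          using rep M'.model_in_E unfolding U' by blast
        fix v
        assume v: "v \<in> E \<and> (\<forall>e\<in>E. UM.functional y (\<Psi> (cnj w) e) = cinner e v)"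
        have "v - U' y w \<in> E"
          using v M'.model_in_E csubspace_simps(4)[OF M.E(1)] unfolding U' by blast
        then have "cinner (v - U' y w) (v - U' y w) = 0"
          using v rep by (simp add: cinner_diff_right)
        then show "v = U' y w" by simp
      qed
      then show ?thesis
        using True by (simp add: \<U>_def dual_map_def)
    qed (simp add: \<U>_def dual_map_def U' laurent_model_def \<Omega>'_def)
  qed
  have dual_space: "dual_space H nrm = range UM.functional"
    unfolding H_def nrm_def
    using UM.functional_in_dual_space UM.dual_space_functional by blast
  have inj: "inj_on \<U> (dual_space H nrm)"
    unfolding dual_space by (rule inj_onI) (auto simp: dual dest: injD[OF UM'.inj_U])
  have "H' = B'"
    unfolding H'_def B'_def cauchy_dual_space_def \<U>_def[symmetric] dual_space
    by (simp add: image_image dual)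
  moreover have "induced_norm U' h = cauchy_dual_norm E \<Omega>' H nrm \<Psi> h" if h: "h \<in> H'" for h
  proof -
    obtain y where y: "h = U' y" using h H'_def by blast
    have "inv_into (dual_space H nrm) \<U> h = UM.functional y"
      unfolding y dual[symmetric] by (rule inv_into_f_f[OF inj]) (simp add: dual_space)
    then show ?thesis
      unfolding cauchy_dual_norm_def \<U>_def[symmetric]
      by (simp add: y H_def nrm_def UM.dual_norm_functional)
  qed
  moreover have "\<U> \<phi> = U' (adjoint_on UNIV cinner ip U g)"
    if \<phi>: "\<phi> \<in> dual_space H nrm" and g: "g \<in> H" "\<forall>f\<in>H. \<phi> f = ip f g" for \<phi> g
  proof -
    obtain x where x: "g = U x" using g(1) H_def by blast
    obtain y where y: "\<phi> = UM.functional y" using \<phi> dual_space by blast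
    have "cinner u y = cinner u x" for u
      using g(2) unfolding y x H_def ip_def by auto
    then have "y = x" by (rule cinner_ext_right)
    then show ?thesis
      by (simp add: y x dual ip_def UM.adjoint_of_U)
  qed
  ultimately show ?thesis by blast
qed

end
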